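(* Suppose that $\mathsf{E}\{\xi\}=0$ and $\mathsf{E}\{\xi^2\}=1$, and that for all sufficiently large $x$ $$F(x+\Delta)=p(x)e^{-c\log^\beta x},$$ where $\beta>1$, $c>0$, and $p$ is long-tailed and intermediate regularly varying at infinity (hence $O$-regularly varying). Let $t>2^{1-\beta}c$. Then $\mathsf{P}\{S_n\in x+\Delta\}\sim nF(x+\Delta)$ as $n\to\infty$: (i) uniformly for $x\ge\sqrt{tn\log^\beta n}$ if $1<\beta<2$; and (ii) uniformly for $x\ge x_n$, for any sequence $\{x_n\}$ with $x_n\gg\sqrt{n\log^{2\beta-2}n}$, if $\beta\ge2$.
   Context: Let $\xi,\xi_1,\xi_2,\dots$ be i.i.d. real random variables with distribution $F$, and $S_n=\xi_1+\cdots+\xi_n$. Fix $T\in(0,\infty]$; put $\Delta=(0,T]$ if $T<\infty$ and $\Delta=(0,\infty)$ if $T=\infty$, and $F(x+\Delta)=\mathsf{P}\{\xi\in x+\Delta\}$ (so $F(x+\Delta)=\mathsf{P}\{\xi>x\}$ when $T=\infty$). $\log^\beta x$ means $(\log x)^\beta$; $f\gg g$ means $g/f\to0$. "$\mathsf{P}\{S_n\in x+\Delta\}\sim nF(x+\Delta)$ uniformly for $x\ge x_n$" means $\lim_{n\to\infty}\sup_{x\ge x_n}\left|\frac{\mathsf{P}\{S_n\in x+\Delta\}}{nF(x+\Delta)}-1\right|=0$. Let $p$ be a positive measurable function defined near infinity. It is long-tailed if $p(x+y)\sim p(x)$ as $x\to\infty$ for every $y\in\mathbb{R}$; $O$-regularly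 varying if $0<\liminf_{x\to\infty}p(xy)/p(x)\le\limsup_{x\to\infty}p(xy)/p(x)<\infty$ for every $y\ge1$; intermediate regularly varying if $\lim_{y\downarrow1}\liminf_{x\to\infty}p(xy)/p(x)=\lim_{y\downarrow1}\limsup_{x\to\infty}p(xy)/p(x)=1$ (this implies $O$-regular variation). *)

theory Defs
  imports "HOL-Probability.Probability" "HOL-Library.Landau_Symbols"
begin

text \<open>\<open>(0, T]\<close> for finite \<open>T\<close>, and \<open>(0, \<infinity>)\<close> for \<open>T = \<infinity>\<close>.\<close>

definition Delta :: "ereal \<Rightarrow> real set" where
  "Delta T = {y. 0 < y \<and> ereal y \<le> T}"

definition shift_Delta :: "real \<Rightarrow> ereal \<Rightarrow> real set" where
  "shift_Delta x T = (+) x ` Delta T"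

text \<open>A function defined near infinity is a total function of which only the values on some
  \<open>[x0, \<infinity>)\<close> matter.\<close>

definition pos_measurable_near_infinity :: "(real \<Rightarrow> real) \<Rightarrow> bool" where
  "pos_measurable_near_infinity p \<longleftrightarrow>
     (\<exists>x0. (\<forall>x\<ge>x0. 0 < p x) \<and> p \<in> borel_measurable (restrict_space borel {x0..}))"

definition long_tailed :: "(real \<Rightarrow> real) \<Rightarrow> bool" where
  "long_tailed p \<longleftrightarrow> (\<forall>y. (\<lambda>x. p (x + y)) \<sim>[at_top] p)"

text \<open>Inferior and superior limits are taken in the extended reals, since for a fixed \<open>y\<close> they may
  be infinite.\<close>

definition intermediate_regularly_varying :: "(real \<Rightarrow> real) \<Rightarrow> bool" where
  "intermediate_regularly_varying p \<longleftrightarrow>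
     ((\<lambda>y. Liminf at_top (\<lambda>x. ereal (p (x * y) / p x))) \<longlongrightarrow> 1) (at_right 1) \<and>
     ((\<lambda>y. Limsup at_top (\<lambda>x. ereal (p (x * y) / p x))) \<longlongrightarrow> 1) (at_right 1)"

text \<open>The supremum is taken in the extended reals: it may be infinite for finitely many \<open>n\<close>.\<close>

definition equiv_uniformly_from ::
  "(nat \<Rightarrow> real \<Rightarrow> real) \<Rightarrow> (nat \<Rightarrow> real \<Rightarrow> real) \<Rightarrow> (nat \<Rightarrow> real) \<Rightarrow> bool" where
  "equiv_uniformly_from f g xs \<longleftrightarrow>
     (\<lambda>n. SUP x\<in>{xs n..}. ereal \<bar>f n x / g n x - 1\<bar>) \<longlonglongrightarrow> 0"

text \<open>The family is indexed from \<open>0\<close>: \<open>\<xi> 0\<close> is the generic variable, and the steps of the random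
  walk are \<open>\<xi> 1, \<xi> 2, \<dots>\<close>.\<close>

definition iid_family :: "'a measure \<Rightarrow> (nat \<Rightarrow> 'a \<Rightarrow> real) \<Rightarrow> real measure \<Rightarrow> bool" where
  "iid_family M \<xi> F \<longleftrightarrow>
     prob_space.indep_vars M (\<lambda>_. borel) \<xi> UNIV \<and> (\<forall>i. distr M borel (\<xi> i) = F)"

definition partial_sum :: "(nat \<Rightarrow> 'a \<Rightarrow> real) \<Rightarrow> nat \<Rightarrow> 'a \<Rightarrow> real" where
  "partial_sum \<xi> n \<omega> = (\<Sum>i=1..n. \<xi> i \<omega>)"

definition local_large_deviations ::
  "'a measure \<Rightarrow> (nat \<Rightarrow> 'a \<Rightarrow> real) \<Rightarrow> real measure \<Rightarrow> ereal \<Rightarrow> (nat \<Rightarrow> real) \<Rightarrow> bool" where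
  "local_large_deviations M \<xi> F T xs \<longleftrightarrow>
     equiv_uniformly_from
       (\<lambda>n x. measure M {\<omega> \<in> space M. partial_sum \<xi> n \<omega> \<in> shift_Delta x T})
       (\<lambda>n x. real n * measure F (shift_Delta x T)) xs"

end

theory Submission
  imports Defs "HOL-Real_Asymp.Real_Asymp"
begin

text \<open>Write \<open>Q(x) = c log\<^sup>\<beta> x\<close> and \<open>g(x) = F(x + \<Delta>) = p(x) exp(- Q(x))\<close>, and split
  \<open>{S\<^sub>n \<in> x + \<Delta>}\<close> according to how many steps exceed \<open>x / 4\<close>. If none does, an exponential bound with
  parameter \<open>2 Q(x) / x\<close> gives \<open>o(g(x))\<close> as soon as \<open>n Q(x) / x\<^sup>2\<close> stays below some \<open>\<rho> < 1 / 2\<close>. Two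
  or more large steps have probability at most \<open>n\<^sup>2 P{\<xi> > x / 4}\<^sup>2\<close>, roughly \<open>exp(- 2 Q(x))\<close>. If exactly
  the \<open>i\<close>th step is large, conditioning on the sum \<open>S\<close> of the other steps yields \<open>E g(x - S)\<close>. Since
  \<open>g(x - y) \<sim> g(x)\<close> when \<open>y log\<^sup>\<beta>\<^sup>-\<^sup>1 x / x\<close> is small, and \<open>g(x - y) / g(x)\<close> is at most
  \<open>C exp(D y\<^sup>+ log\<^sup>\<beta>\<^sup>-\<^sup>1 x / x)\<close> in general, this is \<open>(1 + o(1)) g(x)\<close> as soon as
  \<open>\<surd>n log\<^sup>\<beta>\<^sup>-\<^sup>1 x / x\<close> is small. Both conditions are inherited by larger \<open>x\<close>, so it suffices to check them
  at \<open>x\<^sub>n\<close>.\<close>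

section \<open>Uniformity in intermediate regular variation\<close>

text \<open>The two cases of the theorem reflect a competition between the two smallness conditions.
  The exponential bound wants \<open>n log^\<beta> x / x^2\<close> below a constant; insensitivity
  of \<open>g\<close> wants \<open>n log^(2\<beta>-2) x / x^2\<close> to vanish. If \<beta> < 2 the
  first is more demanding and only a constant is at stake: \<open>ln x\<close> is about half of
  \<open>ln n\<close> on the boundary, whence \<open>2 powr (- \<beta>)\<close> in the bound on
  \<open>t\<close>, and the remaining 2 is the reciprocal of the limit 1/2 for \<rho>. If \<beta>
  \<ge> 2 the second prevails, and the boundary must exceed its natural scale by an unbounded
  factor. The level \<open>x / 4\<close> fits the parameter \<open>s = 2 Q(x) / x\<close>: a
  truncated step contributes at most \<open>exp (s x / 4) = exp (Q / 2)\<close> where it exceeds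
  \<open>x\<close> over a power of \<open>ln x\<close>, an event of probability at most
  \<open>exp (- 3 Q / 4)\<close>, and the product \<open>exp (- Q / 4)\<close> beats every power of
  \<open>x\<close>. The same 3/4 gives the squared tail \<open>exp (- 3 Q / 2)\<close>, below
  \<open>g\<close> with room for powers of \<open>n\<close>. A further obstacle: for finite
  \<open>T\<close> the tail of \<open>F\<close> must be recovered from local probabilities.\<close>

text \<open>Pointwise control of the increments becomes uniform: two subsets of \<open>(0, d)\<close> of measure
  more than \<open>3d/4\<close>, one of them shifted by at most \<open>d/2\<close>, must meet (Steinhaus).\<close>

lemma uniform_increment_bound:
  fixes f :: "real \<Rightarrow> real"
  assumes f [measurable]: "f \<in> borel_measurable borel" and "d > 0"
    and ev: "\<And>u. 0 < u \<Longrightarrow> u < d \<Longrightarrow> \<forall>\<^sub>F s in at_top. \<bar>f (s + u) - f s\<bar> \<le> e"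
  shows "\<exists>S. \<forall>s\<ge>S. \<forall>u. 0 \<le> u \<and> u \<le> d / 2 \<longrightarrow> \<bar>f (s + u) - f s\<bar> \<le> 2 * e"
proof (rule ccontr)
  assume "\<not> ?thesis"
  then have "\<forall>k::nat. \<exists>s u. s \<ge> real k \<and> 0 \<le> u \<and> u \<le> d / 2 \<and> \<bar>f (s + u) - f s\<bar> > 2 * e"
    by (meson not_le)
  then obtain s u where su: "\<And>k::nat. s k \<ge> real k" "\<And>k. 0 \<le> u k" "\<And>k. u k \<le> d / 2"
      "\<And>k. \<bar>f (s k + u k) - f (s k)\<bar> > 2 * e"
    by metis
  \<comment> \<open>\<open>V a N\<close> holds the increments that behave well along
    \<open>a\<close> from index \<open>N\<close> on. By the pointwise hypothesis these sets increase
    to \<open>(0, d)\<close>, which turns eventual statements into a statement about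
    measure.\<close>
  define V where "V a N = {w \<in> {0<..<d}. \<forall>k\<ge>N. \<bar>f (a k + w) - f (a k)\<bar> \<le> e}"
    for a :: "nat \<Rightarrow> real" and N :: nat
  have V_meas [measurable]: "V a N \<in> sets borel" for a N
    unfolding V_def by measurable
  have V_big: "\<exists>N0. \<forall>N\<ge>N0. measure lborel (V a N) > 3 * d / 4"
    if a: "filterlim a at_top sequentially" for a
  proof -
    have inc: "incseq (V a)"
      unfolding V_def incseq_def by auto
    have un: "(\<Union>N. V a N) = {0<..<d}"
    proof
      show "{0<..<d} \<subseteq> (\<Union>N. V a N)"
      proof
        fix w assume w: "w \<in> {0<..<d}"
        have "\<forall>\<^sub>F k in sequentially. \<bar>f (a k + w) - f (a k)\<bar> \<le> e"
          using eventually_compose_filterlim[OF ev a] w by simp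
        then show "w \<in> (\<Union>N. V a N)"
          using w unfolding V_def eventually_sequentially by auto
      qed
    qed (auto simp: V_def)
    have "(\<lambda>N. measure lborel (V a N)) \<longlonglongrightarrow> measure lborel (\<Union>N. V a N)"
    proof (rule Lim_measure_incseq)
      show "emeasure lborel (\<Union>N. V a N) \<noteq> \<infinity>"
        unfolding un using \<open>d > 0\<close> by (simp add: emeasure_lborel_Ioo)
    qed (use inc in auto)
    then have "(\<lambda>N. measure lborel (V a N)) \<longlonglongrightarrow> d"
      unfolding un using \<open>d > 0\<close> by simp
    then have "\<forall>\<^sub>F N in sequentially. measure lborel (V a N) > 3 * d / 4"
      by (rule order_tendstoD) (use \<open>d > 0\<close> in simp)
    then show ?thesis
      by (simp add: eventually_sequentially)
  qed
  have s1: "filterlim s at_top sequentially"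
    by (rule filterlim_at_top_mono[OF filterlim_real_sequentially]) (use su in auto)
  have s2: "filterlim (\<lambda>k. s k + u k) at_top sequentially"
    by (rule filterlim_at_top_mono[OF s1]) (use su in auto)
  obtain N where N: "measure lborel (V s N) > 3 * d / 4"
      "measure lborel (V (\<lambda>k. s k + u k) N) > 3 * d / 4"
    using V_big[OF s1] V_big[OF s2] by (meson nle_le)
  \<comment> \<open>The shift aligns endpoints: a common point \<open>u N + w\<close> is a good
    increment from \<open>s N\<close>, and \<open>w\<close> is a good one from
    \<open>s N + u N\<close>, both ending at \<open>s N + u N + w\<close>. The triangle inequality
    then contradicts the choice of \<open>s\<close> and \<open>u\<close>. Both sets lie in an
    interval of length \<open>3 d / 2\<close>, so they cannot be disjoint.\<close>
  define W where "W = (\<lambda>w. u N + w) ` V (\<lambda>k. s k + u k) N"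
  have W_alt: "W = (\<lambda>w. - u N + w) -` V (\<lambda>k. s k + u k) N \<inter> space lborel"
  proof -
    have "w \<in> W" if "- u N + w \<in> V (\<lambda>k. s k + u k) N" for w
      unfolding W_def using imageI[OF that, of "\<lambda>w. u N + w"] by simp
    then show ?thesis
      unfolding W_def by auto
  qed
  have W_meas [measurable]: "W \<in> sets borel"
  proof -
    have "(+) (- u N) \<in> lborel \<rightarrow>\<^sub>M borel"
      by measurable
    from measurable_sets[OF this V_meas] show ?thesis
      unfolding W_alt by (simp only: sets_lborel)
  qed
  have "emeasure lborel W = emeasure (distr lborel borel ((+) (- u N))) (V (\<lambda>k. s k + u k) N)"
    unfolding W_alt by (subst emeasure_distr) auto
  also have "\<dots> = emeasure lborel (V (\<lambda>k. s k + u k) N)"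
    by (simp only: lborel_distr_plus)
  finally have W_big: "measure lborel W > 3 * d / 4"
    using N(2) by (simp add: measure_def)
  have sub: "V s N \<union> W \<subseteq> {0..3 * d / 2}"
    unfolding W_def using su(2,3)[of N] by (auto simp: V_def)
  have "V s N \<inter> W \<noteq> {}"
  proof
    assume dis: "V s N \<inter> W = {}"
    have fin: "emeasure lborel (V s N) \<noteq> \<infinity>" "emeasure lborel W \<noteq> \<infinity>"
      using emeasure_mono[of "V s N" "{0..3 * d / 2}" lborel] emeasure_mono[of W "{0..3 * d / 2}" lborel]
        sub \<open>d > 0\<close> by (auto simp: top_unique)
    have "measure lborel (V s N \<union> W) = measure lborel (V s N) + measure lborel W"
      by (rule measure_Union) (use fin dis in auto)
    moreover have "measure lborel (V s N \<union> W) \<le> measure lborel {0..3 * d / 2}"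
      by (rule measure_mono_fmeasurable) (use sub \<open>d > 0\<close> in \<open>auto simp: fmeasurable_def\<close>)
    ultimately show False
      using N(1) W_big \<open>d > 0\<close> by simp
  qed
  then obtain w where w: "u N + w \<in> V s N" "w \<in> V (\<lambda>k. s k + u k) N"
    unfolding W_def by auto
  then have "\<bar>f (s N + (u N + w)) - f (s N)\<bar> \<le> e" "\<bar>f (s N + u N + w) - f (s N + u N)\<bar> \<le> e"
    unfolding V_def by auto
  then show False
    using su(4)[of N] by (simp add: add.assoc)
qed

text \<open>In the variable \<open>s = ln x\<close> dilations become translations and ratios of
  \<open>p\<close> become increments of \<open>f s = ln (p (exp s))\<close>. The two limits at
  \<open>y = 1\<close> bound each single increment eventually; the previous lemma makes the
  threshold independent of the increment.\<close>

lemma intermediate_rv_uniform: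
  assumes pm: "pos_measurable_near_infinity p" and irv: "intermediate_regularly_varying p"
    and "e > 0"
  shows "\<exists>d>0. \<exists>X. \<forall>x\<ge>X. \<forall>z. x \<le> z \<and> z \<le> x * (1 + d) \<longrightarrow> \<bar>ln (p z) - ln (p x)\<bar> \<le> e"
proof -
  obtain x0 where x0: "\<And>x. x \<ge> x0 \<Longrightarrow> 0 < p x"
      and p_meas: "p \<in> borel_measurable (restrict_space borel {x0..})"
    using pm unfolding pos_measurable_near_infinity_def by auto
  \<comment> \<open>The value 1 below \<open>x0\<close> yields a function that is Borel on the whole
    line and has a harmless logarithm; only large arguments are ever compared.\<close>
  define q where "q x = (if x \<in> {x0..} then p x else 1)" for x
  have [measurable]: "q \<in> borel_measurable borel"
    unfolding q_def using p_meas by (subst measurable_restrict_space_iff[symmetric]) auto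
  define f where "f s = ln (q (exp s))" for s
  have [measurable]: "f \<in> borel_measurable borel"
    unfolding f_def by measurable
  define r where "r = exp (e / 2)"
  have r: "r > 1"
    using \<open>e > 0\<close> by (simp add: r_def)
  have "\<forall>\<^sub>F y in at_right 1. Liminf at_top (\<lambda>x. ereal (p (x * y) / p x)) > ereal (1 / r) \<and>
          Limsup at_top (\<lambda>x. ereal (p (x * y) / p x)) < ereal r"
    using irv r unfolding intermediate_regularly_varying_def
    by (intro eventually_conj order_tendstoD) (auto simp: one_ereal_def)
  then obtain b :: real where b: "b > 1" and bb: "\<And>y. 1 < y \<Longrightarrow> y < b \<Longrightarrow>
        Liminf at_top (\<lambda>x. ereal (p (x * y) / p x)) > ereal (1 / r) \<and>
        Limsup at_top (\<lambda>x. ereal (p (x * y) / p x)) < ereal r"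
    unfolding eventually_at_right_field by auto
  have ev: "\<forall>\<^sub>F s in at_top. \<bar>f (s + u) - f s\<bar> \<le> e / 2" if u: "0 < u" "u < ln b" for u
  proof -
    have y: "1 < exp u" "exp u < b"
      using u b by (auto, metis exp_less_mono exp_ln less_trans zero_less_one)
    have "\<forall>\<^sub>F x in at_top. ereal (p (x * exp u) / p x) > ereal (1 / r)"
         "\<forall>\<^sub>F x in at_top. ereal (p (x * exp u) / p x) < ereal r"
      by (rule less_LiminfD, rule conjunct1[OF bb[OF y]]) (rule Limsup_lessD, rule conjunct2[OF bb[OF y]])
    moreover have "\<forall>\<^sub>F x in at_top. x \<ge> max x0 1"
      by (rule eventually_ge_at_top)
    ultimately have "\<forall>\<^sub>F x in at_top. \<bar>ln (q (x * exp u)) - ln (q x)\<bar> \<le> e / 2"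
    proof eventually_elim
      case (elim x)
      have "x \<le> x * exp u"
        using elim u by (intro mult_le_cancel_left1[THEN iffD2]) auto
      then have "x * exp u \<ge> x0" "x \<ge> x0"
        using elim by linarith+
      then have pos: "p x > 0" "p (x * exp u) > 0" and eq: "q x = p x" "q (x * exp u) = p (x * exp u)"
        using x0 by (auto simp: q_def)
      have "ln (1 / r) < ln (p (x * exp u) / p x)" "ln (p (x * exp u) / p x) < ln r"
        using elim pos r by (auto intro!: ln_less_cancel_iff[THEN iffD2] divide_pos_pos)
      then have "\<bar>ln (p (x * exp u)) - ln (p x)\<bar> < e / 2"
        using pos r by (simp add: ln_div r_def) argo
      then show ?case
        unfolding eq by simp
    qed
    from eventually_compose_filterlim[OF this exp_at_top] show ?thesis
      by (simp add: f_def exp_add)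
  qed
  have lnb: "ln b > 0"
    using b by simp
  obtain S where S: "\<And>s u. s \<ge> S \<Longrightarrow> 0 \<le> u \<Longrightarrow> u \<le> ln b / 2 \<Longrightarrow> \<bar>f (s + u) - f s\<bar> \<le> e"
    using uniform_increment_bound[of f "ln b" "e / 2"] lnb ev by auto
  define d where "d = exp (ln b / 2) - 1"
  show ?thesis
  proof (intro exI conjI allI impI)
    show "d > 0"
      using lnb by (simp add: d_def)
    fix x z assume x: "max (max x0 1) (exp S) \<le> x" and z: "x \<le> z \<and> z \<le> x * (1 + d)"
    have pos: "x > 0" "z > 0"
      using x z by auto
    define u where "u = ln z - ln x"
    have "S \<le> ln x"
      using x pos by (simp add: ln_ge_iff)
    moreover have "u \<ge> 0"
      using pos z by (simp add: u_def)
    moreover have "ln z \<le> ln (x * (1 + d))"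
      using pos z by (intro ln_mono) auto
    then have "u \<le> ln b / 2"
      using pos by (simp add: u_def d_def ln_mult)
    ultimately have "\<bar>f (ln x + u) - f (ln x)\<bar> \<le> e"
      by (rule S)
    then show "\<bar>ln (p z) - ln (p x)\<bar> \<le> e"
      using pos x z by (simp add: f_def u_def q_def)
  qed
qed

section \<open>Weights of lognormal type\<close>

lemma powr_diff_bounds:
  fixes a b r :: real
  assumes "0 < a" "a \<le> b" "r \<ge> 1"
  shows "b powr r - a powr r \<le> r * b powr (r - 1) * (b - a)"
    and "r * a powr (r - 1) * (b - a) \<le> b powr r - a powr r"
proof -
  have "b powr r - a powr r \<le> r * b powr (r - 1) * (b - a) \<and>
      r * a powr (r - 1) * (b - a) \<le> b powr r - a powr r"
  proof (cases "a = b")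
    case False
    have "((\<lambda>x. x powr r) has_real_derivative r * x powr (r - 1)) (at x)" if "a \<le> x" for x
      using has_real_derivative_powr[of x r] that assms by simp
    then obtain z where z: "a < z" "z < b" "b powr r - a powr r = (b - a) * (r * z powr (r - 1))"
      using MVT2[of a b "\<lambda>x. x powr r" "\<lambda>x. r * x powr (r - 1)"] False assms by auto
    have "z powr (r - 1) \<le> b powr (r - 1)" "a powr (r - 1) \<le> z powr (r - 1)"
      using z assms by (auto intro: powr_mono2)
    then show ?thesis
      unfolding z(3) using assms z
      by (auto simp: mult.commute mult.left_commute intro!: mult_left_mono)
  qed auto
  then show "b powr r - a powr r \<le> r * b powr (r - 1) * (b - a)"
    and "r * a powr (r - 1) * (b - a) \<le> b powr r - a powr r"
    by auto
qed

locale lognormal_weight =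
  fixes p g :: "real \<Rightarrow> real" and c \<beta> :: real
  assumes c: "c > 0" and \<beta>: "\<beta> > 1"
    and p_pos: "\<forall>\<^sub>F x in at_top. 0 < p x"
    and p_uniform: "\<And>e. e > 0 \<Longrightarrow>
      \<exists>d>0. \<exists>X. \<forall>x\<ge>X. \<forall>z. x \<le> z \<and> z \<le> x * (1 + d) \<longrightarrow> \<bar>ln (p z) - ln (p x)\<bar> \<le> e"
    and g_eq: "\<forall>\<^sub>F x in at_top. g x = p x * exp (- c * ln x powr \<beta>)"
begin

definition Q :: "real \<Rightarrow> real" where "Q x = c * ln x powr \<beta>"

text \<open>Up to the factor \<open>c * \<beta>\<close> this is the derivative of \<open>Q\<close>,
  so \<open>1 / lam x\<close> is the distance over which \<open>exp (- Q x)\<close> changes by a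
  constant factor.\<close>

definition lam :: "real \<Rightarrow> real" where "lam x = ln x powr (\<beta> - 1) / x"

lemma Q_nonneg: "Q x \<ge> 0"
  using c by (simp add: Q_def)

lemma Q_mono: "1 \<le> u \<Longrightarrow> u \<le> v \<Longrightarrow> Q u \<le> Q v"
  using c \<beta> by (auto simp: Q_def intro!: mult_left_mono powr_mono2)

text \<open>This is where \<beta> > 1 enters: all factors polynomial in \<open>x\<close> or in
  \<open>n\<close> are later absorbed into an arbitrarily small share of \<open>Q\<close>.\<close>

lemma Q_dominates_ln: "e > 0 \<Longrightarrow> \<forall>\<^sub>F x in at_top. A + B * ln x \<le> e * Q x"
proof -
  assume e: "e > 0"
  have "((\<lambda>x. (A + B * ln x) / (ln x powr \<beta>)) \<longlongrightarrow> 0) at_top"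
    using \<beta> by real_asymp
  then have "\<forall>\<^sub>F x in at_top. (A + B * ln x) / (ln x powr \<beta>) < e * c"
    by (rule order_tendstoD) (use e c in simp)
  moreover have "\<forall>\<^sub>F x::real in at_top. x > 1"
    by (rule eventually_gt_at_top)
  ultimately show ?thesis
  proof eventually_elim
    case (elim x)
    then show ?case
      by (simp add: Q_def field_simps)
  qed
qed

lemma g_pos_ln: "\<forall>\<^sub>F x in at_top. 0 < p x \<and> 0 < g x \<and> ln (g x) = ln (p x) - Q x"
  using p_pos g_eq by eventually_elim (auto simp: ln_mult Q_def)

lemma Q_diff_le:
  assumes "1 < u" "u \<le> v"
  shows "Q v - Q u \<le> c * \<beta> * ln v powr (\<beta> - 1) * (v - u) / u"
proof -
  have "Q v - Q u = c * (ln v powr \<beta> - ln u powr \<beta>)"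
    by (simp add: Q_def algebra_simps)
  also have "\<dots> \<le> c * (\<beta> * ln v powr (\<beta> - 1) * (ln v - ln u))"
    using assms c \<beta> by (intro mult_left_mono powr_diff_bounds) auto
  also have "ln v - ln u \<le> (v - u) / u"
    using assms ln_le_minus_one[of "v / u"] by (simp add: ln_div diff_divide_distrib)
  then have "c * (\<beta> * ln v powr (\<beta> - 1) * (ln v - ln u)) \<le> c * (\<beta> * ln v powr (\<beta> - 1) * ((v - u) / u))"
    using c \<beta> by (intro mult_left_mono) auto
  finally show ?thesis
    by (simp add: algebra_simps)
qed

lemma Q_diff_ge:
  assumes "1 < u" "u \<le> v"
  shows "c * \<beta> * ln u powr (\<beta> - 1) * ln (v / u) \<le> Q v - Q u"
proof -
  have "c * (\<beta> * ln u powr (\<beta> - 1) * (ln v - ln u)) \<le> c * (ln v powr \<beta> - ln u powr \<beta>)"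
    using assms c \<beta> by (intro mult_left_mono powr_diff_bounds) auto
  then show ?thesis
    using assms by (simp add: Q_def algebra_simps ln_div)
qed

text \<open>A Potter-type bound: one passes from \<open>x\<close> to \<open>z\<close> in about
  \<open>ln (z / x) / ln (1 + d)\<close> dilations by at most \<open>1 + d\<close>, each of which
  changes \<open>ln p\<close> by at most 1.\<close>

lemma ln_p_growth:
  "\<exists>\<alpha>>0. \<forall>\<^sub>F x in at_top. \<forall>z\<ge>x. \<bar>ln (p z) - ln (p x)\<bar> \<le> \<alpha> * ln (z / x) + 1"
proof -
  obtain d X where d: "d > 0" and X: "\<And>x z. x \<ge> X \<Longrightarrow> x \<le> z \<Longrightarrow> z \<le> x * (1 + d) \<Longrightarrow> \<bar>ln (p z) - ln (p x)\<bar> \<le> 1"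
    using p_uniform[of 1] by auto
  have steps: "\<bar>ln (p z) - ln (p x)\<bar> \<le> real m"
    if "x \<ge> max X 1" "x \<le> z" "z \<le> x * (1 + d) ^ m" for m x z
    using that(2,3)
  proof (induction m arbitrary: z)
    case (Suc m)
    \<comment> \<open>The last intermediate point; the maximum keeps it from falling below
      \<open>x\<close>, where nothing is known about \<open>p\<close>.\<close>
    define w where "w = max x (z / (1 + d))"
    have zd: "z / (1 + d) \<le> z"
      using that Suc.prems d by (auto simp: field_simps)
    have "x * 1 \<le> x * (1 + d) ^ m"
      using that d by (intro mult_left_mono one_le_power) auto
    then have w: "x \<le> w" "w \<le> x * (1 + d) ^ m" "w \<le> z"
      using Suc.prems d zd by (auto simp: w_def field_simps)
    have "z = z / (1 + d) * (1 + d)"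
      using d by simp
    also have "\<dots> \<le> w * (1 + d)"
      using d by (intro mult_right_mono) (auto simp: w_def)
    finally have "\<bar>ln (p z) - ln (p w)\<bar> \<le> 1"
      using X[of w z] w that by auto
    with Suc.IH[OF w(1,2)] show ?case
      by simp
  qed simp
  define \<alpha> where "\<alpha> = 1 / ln (1 + d)"
  have \<alpha>: "\<alpha> > 0"
    using d by (simp add: \<alpha>_def)
  have "\<bar>ln (p z) - ln (p x)\<bar> \<le> \<alpha> * ln (z / x) + 1" if x: "x \<ge> max X 1" "z \<ge> x" for x z
  proof -
    define m where "m = nat \<lceil>\<alpha> * ln (z / x)\<rceil>"
    have l: "ln (z / x) \<ge> 0"
      using x by simp
    have m: "\<alpha> * ln (z / x) \<le> real m" "real m \<le> \<alpha> * ln (z / x) + 1"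
      using l \<alpha> unfolding m_def by (auto simp: real_nat_ceiling_ge intro!: less_imp_le)
    have "ln (z / x) = ln (1 + d) * (\<alpha> * ln (z / x))"
      using d by (simp add: \<alpha>_def)
    also have "\<dots> \<le> ln (1 + d) * real m"
      using d m by (intro mult_left_mono) auto
    finally have "exp (ln (z / x)) \<le> exp (ln (1 + d) * real m)"
      by simp
    then have "z / x \<le> (1 + d) ^ m"
      using d x by (simp add: mult.commute exp_of_nat_mult)
    then have "z \<le> x * (1 + d) ^ m"
      using x by (simp add: field_simps)
    from steps[OF x this] m(2) show ?thesis
      by simp
  qed
  then show ?thesis
    using \<alpha> unfolding eventually_at_top_linorder by blast
qed

text \<open>With a fixed base point \<open>X\<close> in the growth bound, \<open>ln p\<close> is of
  order \<open>ln x\<close>, which \<open>Q\<close> dominates. On the exponential scale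
  \<open>p\<close> is therefore invisible.\<close>

lemma ln_p_small: "e > 0 \<Longrightarrow> \<forall>\<^sub>F x in at_top. \<bar>ln (p x)\<bar> \<le> e * Q x"
proof -
  assume e: "e > 0"
  obtain \<alpha> where \<alpha>: "\<alpha> > 0" "\<forall>\<^sub>F x in at_top. \<forall>z\<ge>x. \<bar>ln (p z) - ln (p x)\<bar> \<le> \<alpha> * ln (z / x) + 1"
    using ln_p_growth by auto
  with eventually_ge_at_top[of 1] have "\<forall>\<^sub>F x in at_top. x \<ge> 1 \<and> (\<forall>z\<ge>x. \<bar>ln (p z) - ln (p x)\<bar> \<le> \<alpha> * ln (z / x) + 1)"
    by (auto intro: eventually_conj)
  then obtain X where X: "X \<ge> 1" "\<And>z. z \<ge> X \<Longrightarrow> \<bar>ln (p z) - ln (p X)\<bar> \<le> \<alpha> * ln (z / X) + 1"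
    unfolding eventually_at_top_linorder by blast
  have "\<forall>\<^sub>F x in at_top. (\<bar>ln (p X)\<bar> + 1) + \<alpha> * ln x \<le> e * Q x" "\<forall>\<^sub>F x in at_top. x \<ge> X"
    using Q_dominates_ln[OF e] eventually_ge_at_top by auto
  then show ?thesis
  proof eventually_elim
    case (elim x)
    have "\<alpha> * ln (x / X) \<le> \<alpha> * ln x"
      using X(1) elim \<alpha> by (intro mult_left_mono) (auto simp: ln_div)
    then show ?case
      using X(2)[of x] elim by linarith
  qed
qed

lemma g_bounds:
  assumes "e > 0"
  shows "\<forall>\<^sub>F x in at_top. exp (- (1 + e) * Q x) \<le> g x \<and> g x \<le> exp (- (1 - e) * Q x)"
  using ln_p_small[OF assms] g_pos_ln
proof eventually_elim
  case (elim x)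
  then have "- (1 + e) * Q x \<le> ln (g x)" "ln (g x) \<le> - (1 - e) * Q x"
    by (auto simp: algebra_simps)
  then have "exp (- (1 + e) * Q x) \<le> exp (ln (g x))" "exp (ln (g x)) \<le> exp (- (1 - e) * Q x)"
    by (simp_all only: exp_le_cancel_iff)
  moreover have "exp (ln (g x)) = g x"
    using elim by (intro exp_ln) auto
  ultimately show ?case
    by (simp only:)
qed

lemma lam_pos: "x > 1 \<Longrightarrow> lam x > 0"
  by (simp add: lam_def)

lemma lam_ge: "x \<ge> exp 1 \<Longrightarrow> 1 / x \<le> lam x"
proof -
  assume x: "x \<ge> exp 1"
  then have "x > 0" "ln x \<ge> 1"
    using ln_ge_iff[of x 1] by (auto intro: less_le_trans[OF exp_gt_zero])
  then show ?thesis
    using \<beta> by (simp add: lam_def divide_right_mono ge_one_powr_ge_zero)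
qed

text \<open>A shift that is small on the scale \<open>1 / lam x\<close> changes \<open>Q\<close>
  little because \<open>lam\<close> is essentially its derivative. As
  \<open>1 / x \<le> lam x\<close>, it is also a small proportion of \<open>x\<close>, so the
  uniform bound for \<open>p\<close> applies. Each factor of \<open>g\<close> gets half of
  \<open>ln (1 + e)\<close>.\<close>

lemma g_insensitive:
  assumes "e > 0"
  shows "\<exists>\<eta>>0. \<forall>\<^sub>F x in at_top. \<forall>y. \<bar>y\<bar> * lam x \<le> \<eta> \<longrightarrow> \<bar>g (x - y) - g x\<bar> \<le> e * g x"
proof -
  define e' where "e' = ln (1 + e) / 2"
  have e': "e' > 0"
    using assms by (simp add: e'_def)
  obtain d X where d: "d > 0" and X: "\<And>x z. x \<ge> X \<Longrightarrow> x \<le> z \<Longrightarrow> z \<le> x * (1 + d) \<Longrightarrow> \<bar>ln (p z) - ln (p x)\<bar> \<le> e'"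
    using p_uniform[OF e'] by auto
  \<comment> \<open>The factor \<open>2 powr (\<beta> - 1)\<close> pays for
    \<open>ln v \<le> 2 * ln w\<close>, the last 2 for \<open>w / u \<le> 2\<close>.\<close>
  define B where "B = c * \<beta> * 2 powr (\<beta> - 1) * 2"
  have B: "B > 0"
    using c \<beta> by (simp add: B_def)
  \<comment> \<open>The bound 1/2 keeps \<open>x - y\<close> above \<open>x / 2\<close>, the bound
    \<open>d / (1 + d)\<close> is what \<open>x \<le> (x - y) * (1 + d)\<close> requires, and
    \<open>e' / B\<close> controls the increment of \<open>Q\<close>.\<close>
  define \<eta> where "\<eta> = min (min (1 / 2) (d / (1 + d))) (e' / B)"
  have \<eta>: "\<eta> > 0" "\<eta> \<le> 1 / 2" "\<eta> \<le> d / (1 + d)" "B * \<eta> \<le> e'"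
  proof -
    show "\<eta> > 0"
      using d e' B by (simp add: \<eta>_def)
    show "\<eta> \<le> 1 / 2" "\<eta> \<le> d / (1 + d)"
      unfolding \<eta>_def by linarith+
    have "\<eta> \<le> e' / B"
      by (simp add: \<eta>_def)
    then show "B * \<eta> \<le> e'"
      using B by (simp add: field_simps)
  qed
  have \<eta>d: "\<eta> \<le> d"
    using \<eta>(3) d by (smt (verit) divide_le_eq mult_le_cancel_left1)
  obtain Y where Y: "\<And>x. x \<ge> Y \<Longrightarrow> 0 < p x \<and> 0 < g x \<and> ln (g x) = ln (p x) - Q x"
    using g_pos_ln unfolding eventually_at_top_linorder by auto
  \<comment> \<open>A separate reference point \<open>w\<close> is carried along because
    \<open>x\<close> is the right endpoint for \<open>y \<ge> 0\<close> and the left one for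
    \<open>y < 0\<close>.\<close>
  have close: "\<bar>ln (g v) - ln (g u)\<bar> \<le> ln (1 + e)"
    if uv: "u \<ge> max (max X Y) (exp 1)" "u \<le> v" "v \<le> u * (1 + d)" and w: "v \<le> 2 * w" "w \<le> 2 * u" "(v - u) * lam w \<le> \<eta>" "w \<ge> exp 1" for u v w
  proof -
    have pos: "u > 1" "w > 1"
      using uv w exp_ge_add_one_self[of 1] by linarith+
    have ln2: "ln 2 \<le> (1::real)"
      using ln_2_less_1 by simp
    have "1 \<le> ln w"
      using w pos by (simp add: ln_ge_iff)
    have "ln v \<le> ln (2 * w)"
      using uv w pos by (intro ln_mono) auto
    also have "\<dots> \<le> 2 * ln w"
      using \<open>1 \<le> ln w\<close> ln2 ln_mult_pos[of 2 w] pos by linarith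
    finally have "ln v powr (\<beta> - 1) \<le> (2 * ln w) powr (\<beta> - 1)"
      using uv pos \<beta> by (intro powr_mono2) auto
    also have "\<dots> = 2 powr (\<beta> - 1) * (lam w * w)"
      using pos by (simp add: lam_def powr_mult)
    finally have L: "ln v powr (\<beta> - 1) \<le> 2 powr (\<beta> - 1) * (lam w * w)" .
    have "Q v - Q u \<le> c * \<beta> * ln v powr (\<beta> - 1) * ((v - u) / u)"
      using Q_diff_le[of u v] pos uv by simp
    also have "\<dots> \<le> c * \<beta> * (2 powr (\<beta> - 1) * (lam w * w)) * ((v - u) / u)"
      using L c \<beta> pos uv by (intro mult_right_mono mult_left_mono) auto
    also have "\<dots> = c * \<beta> * 2 powr (\<beta> - 1) * (w / u) * ((v - u) * lam w)"
      by simp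
    also have "\<dots> \<le> c * \<beta> * 2 powr (\<beta> - 1) * 2 * \<eta>"
      using w uv pos c \<beta> lam_pos[of w] by (intro mult_mono mult_left_mono) (auto simp: divide_le_eq)
    also have "\<dots> \<le> e'"
      using \<eta>(4) by (simp add: B_def)
    finally have "Q v - Q u \<le> e'" .
    moreover have "Q u \<le> Q v"
      using pos uv by (intro Q_mono) auto
    moreover have "\<bar>ln (p v) - ln (p u)\<bar> \<le> e'"
      using X uv by auto
    moreover have "ln (g v) = ln (p v) - Q v" "ln (g u) = ln (p u) - Q u"
      using Y[of u] Y[of v] uv by auto
    ultimately show ?thesis
      unfolding e'_def by linarith
  qed
  have "\<bar>g (x - y) - g x\<bar> \<le> e * g x"
    if x: "x \<ge> 2 * max (max X Y) (exp 1)" and y: "\<bar>y\<bar> * lam x \<le> \<eta>" for x y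
  proof -
    have "exp 1 \<le> max (max X Y) (exp 1)" "X \<le> max (max X Y) (exp 1)" "Y \<le> max (max X Y) (exp 1)"
      by auto
    then have xe: "x \<ge> 2 * exp 1" "x \<ge> 2 * X" "x \<ge> 2 * Y" "x \<ge> exp 1"
      using x exp_gt_zero[of "1::real"] by linarith+
    have x0: "x > 0"
      using xe exp_gt_zero[of "1::real"] by linarith
    have "\<bar>y\<bar> * (1 / x) \<le> \<eta>"
      using mult_left_mono[OF lam_ge[OF xe(4)], of "\<bar>y\<bar>"] y by simp
    then have y1: "\<bar>y\<bar> \<le> \<eta> * x"
      using x0 by (simp add: field_simps)
    have "\<eta> * x \<le> 1 / 2 * x"
      using x0 \<eta>(2) by (intro mult_right_mono) auto
    then have y2: "\<bar>y\<bar> \<le> x / 2"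
      using y1 by simp
    have "\<bar>ln (g (x - y)) - ln (g x)\<bar> \<le> ln (1 + e)"
    proof (cases "y \<ge> 0")
      case True
      have "\<eta> * (1 + d) \<le> d"
        using \<eta>(3) d by (simp add: field_simps)
      from mult_right_mono[OF this, of x] have "\<eta> * x * (1 + d) \<le> d * x"
        using x0 by (simp add: algebra_simps)
      moreover have "y * (1 + d) \<le> \<eta> * x * (1 + d)"
        using y1 d True by (intro mult_right_mono) auto
      ultimately have "x \<le> (x - y) * (1 + d)"
        by (simp add: algebra_simps)
      moreover have "x - y \<ge> x / 2"
        using y2 True by simp
      ultimately have "\<bar>ln (g x) - ln (g (x - y))\<bar> \<le> ln (1 + e)"
        using True y x0 xe y2 by (intro close[of _ _ x]) auto
      then show ?thesis
        by simp
    next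
      case False
      have "\<eta> * x \<le> d * x"
        using \<eta>d x0 by simp
      then have "x - y \<le> x * (1 + d)"
        using y1 by (simp add: algebra_simps)
      then show ?thesis
        using False y x0 xe y2 x exp_gt_zero[of "1::real"] by (intro close[of _ _ x]) auto
    qed
    moreover have gp: "g x > 0" "g (x - y) > 0"
      using Y[of x] Y[of "x - y"] xe y2 x by (auto simp: max_def split: if_splits)
    ultimately have "ln (g (x - y)) \<le> ln ((1 + e) * g x)" "ln (g x) \<le> ln ((1 + e) * g (x - y))"
      using assms by (auto simp: ln_mult abs_le_iff)
    then have *: "g (x - y) \<le> (1 + e) * g x" "g x \<le> (1 + e) * g (x - y)"
      using gp assms by (auto simp: ln_le_cancel_iff)
    show ?thesis
    proof (cases "g x \<le> g (x - y)")
      case False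
      then have "e * g (x - y) \<le> e * g x"
        using assms by simp
      with * False show ?thesis
        by (simp add: algebra_simps)
    qed (use * in \<open>simp add: algebra_simps\<close>)
  qed
  then show ?thesis
    using \<eta>(1) unfolding eventually_at_top_linorder by blast
qed

text \<open>To the right of \<open>x\<close> the possible growth of \<open>p\<close> is a fixed
  multiple of \<open>ln (z / x)\<close>, while \<open>Q\<close> grows at least by a multiple that
  tends to infinity, so \<open>g\<close> gains at most a constant. To the left, \<open>p\<close>
  costs a constant since \<open>x / z \<le> 8\<close>, and \<open>Q\<close> changes at most linearly
  in \<open>x - z\<close>; the 8 in \<open>D\<close> bounds the slope at the far end
  \<open>x / 8\<close>.\<close>

lemma g_dominated:
  "\<exists>C\<ge>1. \<exists>D>0. \<forall>\<^sub>F x in at_top. \<forall>z\<ge>x / 8. g z \<le> C * g x * exp (D * max (x - z) 0 * lam x)"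
proof -
  obtain \<alpha> where \<alpha>: "\<alpha> > 0" and "\<forall>\<^sub>F x in at_top. \<forall>z\<ge>x. \<bar>ln (p z) - ln (p x)\<bar> \<le> \<alpha> * ln (z / x) + 1"
    using ln_p_growth by auto
  then obtain X where X: "\<And>x z. x \<ge> X \<Longrightarrow> z \<ge> x \<Longrightarrow> \<bar>ln (p z) - ln (p x)\<bar> \<le> \<alpha> * ln (z / x) + 1"
    unfolding eventually_at_top_linorder by blast
  obtain Y where Y: "\<And>x. x \<ge> Y \<Longrightarrow> 0 < p x \<and> 0 < g x \<and> ln (g x) = ln (p x) - Q x"
    using g_pos_ln unfolding eventually_at_top_linorder by auto
  have "filterlim (\<lambda>x. c * \<beta> * ln x powr (\<beta> - 1)) at_top at_top"
    using c \<beta> by real_asymp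
  then have "\<forall>\<^sub>F x in at_top. c * \<beta> * ln x powr (\<beta> - 1) \<ge> \<alpha>"
    by (simp add: filterlim_at_top)
  then obtain W where W: "\<And>x. x \<ge> W \<Longrightarrow> c * \<beta> * ln x powr (\<beta> - 1) \<ge> \<alpha>"
    unfolding eventually_at_top_linorder by blast
  define A where "A = \<alpha> * ln 8 + 1"
  define D where "D = 8 * c * \<beta>"
  have A: "A \<ge> 1" and D: "D > 0"
    using \<alpha> c \<beta> by (auto simp: A_def D_def)
  have "g z \<le> exp A * g x * exp (D * max (x - z) 0 * lam x)"
    if x: "x \<ge> 8 * max (max (max X Y) W) 2" and z: "z \<ge> x / 8" for x z
  proof -
    have x': "x / 8 \<ge> X" "x / 8 \<ge> Y" "x \<ge> W" "x / 8 > 1" "x > 0" "x \<ge> X" "x \<ge> Y" "z > 0"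
      using x z by auto
    have "ln (g z) - ln (g x) \<le> A + D * max (x - z) 0 * lam x"
    proof (cases "x \<le> z")
      case True
      have "ln (p z) - ln (p x) \<le> \<alpha> * ln (z / x) + 1"
        using X[of x z] x' True by auto
      also have "\<alpha> * ln (z / x) \<le> c * \<beta> * ln x powr (\<beta> - 1) * ln (z / x)"
        using W[of x] x' True by (intro mult_right_mono) auto
      also have "\<dots> \<le> Q z - Q x"
        using Q_diff_ge[of x z] x' True by auto
      finally show ?thesis
        using Y[of x] Y[of z] x' True A by auto
    next
      case False
      have "ln (p z) - ln (p x) \<le> \<alpha> * ln (x / z) + 1"
        using X[of z x] x' z False by auto
      also have "\<alpha> * ln (x / z) \<le> \<alpha> * ln 8"
        using \<alpha> x' z False by (intro mult_left_mono ln_mono) (auto simp: field_simps)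
      finally have 1: "ln (p z) - ln (p x) \<le> A"
        by (simp add: A_def)
      have "Q x - Q z \<le> c * \<beta> * ln x powr (\<beta> - 1) * ((x - z) / z)"
        using Q_diff_le[of z x] x' z False by auto
      also have "\<dots> \<le> c * \<beta> * ln x powr (\<beta> - 1) * ((x - z) / (x / 8))"
        using c \<beta> x' z False by (intro mult_left_mono divide_left_mono) auto
      also have "\<dots> = D * max (x - z) 0 * lam x"
        using False by (simp add: D_def lam_def)
      finally show ?thesis
        using 1 Y[of x] Y[of z] x' z by auto
    qed
    then have "exp (ln (g z)) \<le> exp (A + ln (g x) + D * max (x - z) 0 * lam x)"
      by simp
    moreover have "g x > 0" "g z > 0"
      using Y[of x] Y[of z] x' z by auto
    then have "exp (ln (g x)) = g x" "exp (ln (g z)) = g z"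
      by simp_all
    ultimately show ?thesis
      by (simp only: exp_add)
  qed
  moreover have "exp A \<ge> 1"
    using A by simp
  ultimately show ?thesis
    using D unfolding eventually_at_top_linorder by blast
qed

end

section \<open>Truncated sums of independent steps\<close>

text \<open>For \<open>u \<ge> 0\<close> this is Taylor with the remainder factor at most
  \<open>1 + e\<close>. For \<open>u = - v < 0\<close> it follows from the quadratic lower bound of
  \<open>exp v\<close> and the identity
  \<open>(1 - v + v^2/2) (1 + v + v^2/2) = 1 + v^4/4\<close>.\<close>

lemma exp_le_quadratic:
  fixes e u :: real
  assumes "e > 0" "u \<le> ln (1 + e)"
  shows "exp u \<le> 1 + u + (1 + e) * u\<^sup>2 / 2"
proof (cases "u \<ge> 0")
  case True
  obtain t where t: "\<bar>t\<bar> \<le> \<bar>u\<bar>" "exp u = (\<Sum>m<2. u ^ m / fact m) + exp t / fact 2 * u ^ 2"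
    using Maclaurin_exp_le[of u 2] by blast
  have "exp t \<le> exp (ln (1 + e))"
    using t(1) True assms(2) by (simp only: exp_le_cancel_iff)
  then have "exp t * u\<^sup>2 \<le> (1 + e) * u\<^sup>2"
    using assms by (intro mult_right_mono) auto
  with t(2) show ?thesis
    by (simp add: numeral_2_eq_2 field_simps)
next
  case False
  define v where "v = - u"
  have v: "v > 0"
    using False by (simp add: v_def)
  have "1 + v + v\<^sup>2 / 2 \<le> exp v"
    using exp_lower_Taylor_quadratic[of v] v by simp
  then have "1 / exp v \<le> 1 / (1 + v + v\<^sup>2 / 2)"
    using v by (intro divide_left_mono mult_pos_pos add_pos_nonneg) auto
  also have "\<dots> \<le> 1 - v + v\<^sup>2 / 2"
  proof -
    have "(1 - v + v\<^sup>2 / 2) * (1 + v + v\<^sup>2 / 2) = 1 + v ^ 4 / 4"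
      by (simp add: field_simps power2_eq_square power4_eq_xxxx)
    then have "1 \<le> (1 - v + v\<^sup>2 / 2) * (1 + v + v\<^sup>2 / 2)"
      by simp
    moreover have "1 + v + v\<^sup>2 / 2 > 0"
      using v by (simp add: add_pos_nonneg)
    ultimately show ?thesis
      by (simp add: divide_le_eq)
  qed
  also have "v\<^sup>2 / 2 \<le> (1 + e) * v\<^sup>2 / 2"
    using assms by (simp add: algebra_simps)
  finally show ?thesis
    by (simp add: v_def exp_minus inverse_eq_divide)
qed

text \<open>Fubini for the product law, conditioning on \<open>Y\<close>. The measurability of the
  inner probability is stated too, since it is later integrated against explicit bounds.\<close>

lemma (in prob_space) prob_indep_pair:
  assumes ind: "indep_var N1 X N2 Y" and A [measurable]: "A \<in> sets (N1 \<Otimes>\<^sub>M N2)"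
  shows "prob {\<omega> \<in> space M. (X \<omega>, Y \<omega>) \<in> A} =
      expectation (\<lambda>\<omega>. measure (distr M N1 X) {x \<in> space N1. (x, Y \<omega>) \<in> A})"
    and "(\<lambda>\<omega>. measure (distr M N1 X) {x \<in> space N1. (x, Y \<omega>) \<in> A}) \<in> borel_measurable M"
proof -
  have [measurable]: "X \<in> measurable M N1" "Y \<in> measurable M N2"
    using ind indep_var_rv1 indep_var_rv2 by blast+
  interpret X: prob_space "distr M N1 X"
    by (rule prob_space_distr) simp
  interpret Y: prob_space "distr M N2 Y"
    by (rule prob_space_distr) simp
  interpret XY: pair_prob_space "distr M N1 X" "distr M N2 Y" ..
  have sec: "(\<lambda>x. (x, y)) -` A = {x \<in> space N1. (x, y) \<in> A}" for y
    using sets.sets_into_space[OF A] by (auto simp: space_pair_measure)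
  have Am: "A \<in> sets (distr M N1 X \<Otimes>\<^sub>M distr M N2 Y)"
    using A by (simp cong: sets_pair_measure_cong)
  have em: "(\<lambda>y. emeasure (distr M N1 X) {x \<in> space N1. (x, y) \<in> A}) \<in> borel_measurable N2"
    using XY.measurable_emeasure_Pair2[OF Am] unfolding sec by simp
  then have "(\<lambda>y. measure (distr M N1 X) {x \<in> space N1. (x, y) \<in> A}) \<in> borel_measurable N2"
    unfolding measure_def by measurable
  then show m: "(\<lambda>\<omega>. measure (distr M N1 X) {x \<in> space N1. (x, Y \<omega>) \<in> A}) \<in> borel_measurable M"
    by (rule measurable_compose[rotated]) simp
  have "emeasure M {\<omega> \<in> space M. (X \<omega>, Y \<omega>) \<in> A} = emeasure (distr M (N1 \<Otimes>\<^sub>M N2) (\<lambda>\<omega>. (X \<omega>, Y \<omega>))) A"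
    by (subst emeasure_distr) (auto intro!: arg_cong[where f="emeasure M"])
  also have "\<dots> = emeasure (distr M N1 X \<Otimes>\<^sub>M distr M N2 Y) A"
    using ind by (simp add: indep_var_distribution_eq)
  also have "\<dots> = (\<integral>\<^sup>+y. emeasure (distr M N1 X) {x \<in> space N1. (x, y) \<in> A} \<partial>distr M N2 Y)"
    by (subst XY.emeasure_pair_measure_alt2[OF Am]) (simp add: sec)
  also have "\<dots> = (\<integral>\<^sup>+\<omega>. emeasure (distr M N1 X) {x \<in> space N1. (x, Y \<omega>) \<in> A} \<partial>M)"
    by (rule nn_integral_distr) (use em in auto)
  also have "\<dots> = (\<integral>\<^sup>+\<omega>. ennreal (measure (distr M N1 X) {x \<in> space N1. (x, Y \<omega>) \<in> A}) \<partial>M)"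
    by (simp add: X.emeasure_eq_measure)
  finally show "prob {\<omega> \<in> space M. (X \<omega>, Y \<omega>) \<in> A} =
      expectation (\<lambda>\<omega>. measure (distr M N1 X) {x \<in> space N1. (x, Y \<omega>) \<in> A})"
    using m by (subst integral_eq_nn_integral) (auto simp: measure_def)
qed

lemma shift_Delta_eq: "shift_Delta x T = {w. x < w \<and> ereal (w - x) \<le> T}"
proof -
  have "w \<in> (+) x ` Delta T" if "x < w" "ereal (w - x) \<le> T" for w
    using that by (intro image_eqI[of _ _ "w - x"]) (auto simp: Delta_def)
  then show ?thesis
    unfolding shift_Delta_def Delta_def by auto
qed

section \<open>Random walk with centred steps of unit variance: moments and truncated exponential
  bounds\<close>

locale iid_walk = prob_space M for M :: "'a measure" +
  fixes \<xi> :: "nat \<Rightarrow> 'a \<Rightarrow> real" and F :: "real measure"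
  assumes indep: "indep_vars (\<lambda>_. borel) \<xi> UNIV"
    and distr_step: "\<And>i. distr M borel (\<xi> i) = F"
    and integrable_step: "integrable M (\<xi> 0)" and mean_step: "expectation (\<xi> 0) = 0"
    and integrable_square: "integrable M (\<lambda>\<omega>. (\<xi> 0 \<omega>)\<^sup>2)"
    and variance_step: "expectation (\<lambda>\<omega>. (\<xi> 0 \<omega>)\<^sup>2) = 1"
begin

definition S :: "nat set \<Rightarrow> 'a \<Rightarrow> real" where "S J \<omega> = (\<Sum>j\<in>J. \<xi> j \<omega>)"

definition small :: "real \<Rightarrow> nat set \<Rightarrow> 'a set" where
  "small h J = {\<omega> \<in> space M. \<forall>j\<in>J. \<xi> j \<omega> \<le> h}"

definition Ftail :: "real \<Rightarrow> real" where "Ftail y = measure F {y<..}"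

text \<open>Values above \<open>h\<close> are cut to 0 rather than conditioned away. Thus its powers
  are exactly the expectations of \<open>exp (s * S J)\<close> over the event
  \<open>small h J\<close>.\<close>

definition mgf_upto :: "real \<Rightarrow> real \<Rightarrow> real" where
  "mgf_upto s h = (\<integral>y. exp (s * y) * indicator {..h} y \<partial>F)"

lemma step_measurable [measurable]: "\<xi> i \<in> borel_measurable M"
  using indep by (auto simp: indep_vars_def)

lemma S_measurable [measurable]: "S J \<in> borel_measurable M"
  unfolding S_def by measurable

lemma small_measurable [measurable]: "finite J \<Longrightarrow> small h J \<in> events"
  unfolding small_def by measurable

lemma sets_F [measurable_cong, simp]: "sets F = sets borel"
  using distr_step[of 0] by auto

lemma space_F [simp]: "space F = UNIV"
  using sets_eq_imp_space_eq[OF sets_F] by simp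

sublocale F: prob_space F
  using prob_space_distr[OF step_measurable[of 0]] distr_step[of 0] by simp

lemma prob_step: "A \<in> sets borel \<Longrightarrow> prob {\<omega> \<in> space M. \<xi> i \<omega> \<in> A} = measure F A"
  unfolding distr_step[of i, symmetric] by (subst measure_distr) (auto intro!: arg_cong[where f=prob])

lemma expectation_step:
  fixes f :: "real \<Rightarrow> real"
  shows "f \<in> borel_measurable borel \<Longrightarrow> expectation (\<lambda>\<omega>. f (\<xi> i \<omega>)) = (\<integral>y. f y \<partial>F)"
  using integral_distr[of "\<xi> i" M borel f] by (simp add: distr_step)

lemma integrable_step_iff:
  fixes f :: "real \<Rightarrow> real"
  shows "f \<in> borel_measurable borel \<Longrightarrow> integrable M (\<lambda>\<omega>. f (\<xi> i \<omega>)) \<longleftrightarrow> integrable F f"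
  using integrable_distr_eq[of "\<xi> i" M borel f] by (simp add: distr_step)

lemma F_moments:
  "integrable F (\<lambda>y. y)" "(\<integral>y. y \<partial>F) = 0" "integrable F (\<lambda>y. y\<^sup>2)" "(\<integral>y. y\<^sup>2 \<partial>F) = 1"
proof -
  show "integrable F (\<lambda>y. y)"
    by (rule integrable_step_iff[of "\<lambda>y. y" 0, THEN iffD1]) (simp_all add: integrable_step)
  show "integrable F (\<lambda>y. y\<^sup>2)"
    by (rule integrable_step_iff[of "\<lambda>y. y\<^sup>2" 0, THEN iffD1]) (simp_all add: integrable_square)
  show "(\<integral>y. y \<partial>F) = 0"
    by (rule trans[OF expectation_step[of "\<lambda>y. y" 0, symmetric] mean_step]) simp
  show "(\<integral>y. y\<^sup>2 \<partial>F) = 1"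
    by (rule trans[OF expectation_step[of "\<lambda>y. y\<^sup>2" 0, symmetric] variance_step]) simp
qed

lemma indep_step_rest:
  "finite J \<Longrightarrow> i \<notin> J \<Longrightarrow> indep_var borel (\<xi> i) borel (S J)"
  unfolding S_def by (intro indep_vars_sum indep_vars_subset[OF indep]) auto

lemma S_moments:
  assumes "finite J"
  shows "integrable M (S J) \<and> expectation (S J) = 0 \<and>
    integrable M (\<lambda>\<omega>. (S J \<omega>)\<^sup>2) \<and> expectation (\<lambda>\<omega>. (S J \<omega>)\<^sup>2) = card J"
  using assms
proof (induction J rule: finite_induct)
  case (insert i J)
  have S: "S (insert i J) \<omega> = \<xi> i \<omega> + S J \<omega>" for \<omega>
    using insert by (simp add: S_def)
  have step: "integrable M (\<xi> i)" "expectation (\<xi> i) = 0" "integrable M (\<lambda>\<omega>. (\<xi> i \<omega>)\<^sup>2)"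
      "expectation (\<lambda>\<omega>. (\<xi> i \<omega>)\<^sup>2) = 1"
  proof -
    show "integrable M (\<xi> i)"
      by (rule integrable_step_iff[of "\<lambda>y. y" i, THEN iffD2]) (simp_all add: F_moments(1))
    show "integrable M (\<lambda>\<omega>. (\<xi> i \<omega>)\<^sup>2)"
      by (rule integrable_step_iff[of "\<lambda>y. y\<^sup>2" i, THEN iffD2]) (simp_all add: F_moments(3))
    show "expectation (\<xi> i) = 0"
      by (rule trans[OF expectation_step[of "\<lambda>y. y" i] F_moments(2)]) simp
    show "expectation (\<lambda>\<omega>. (\<xi> i \<omega>)\<^sup>2) = 1"
      by (rule trans[OF expectation_step[of "\<lambda>y. y\<^sup>2" i] F_moments(4)]) simp
  qed
  have "integrable M (\<lambda>\<omega>. \<xi> i \<omega> * S J \<omega>)" "expectation (\<lambda>\<omega>. \<xi> i \<omega> * S J \<omega>) = 0"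
    using indep_var_integrable[OF indep_step_rest[of J i]]
      indep_var_lebesgue_integral[OF indep_step_rest[of J i]] insert step by auto
  then show ?case
    using insert step unfolding S by (simp add: power2_sum mult.assoc Bochner_Integration.integral_add)
qed (simp add: S_def)

lemma S_Chebyshev:
  assumes "finite J" "a > 0"
  shows "prob {\<omega> \<in> space M. \<bar>S J \<omega>\<bar> > a} \<le> card J / a\<^sup>2"
proof -
  have "prob {\<omega> \<in> space M. \<bar>S J \<omega>\<bar> > a} \<le> prob {\<omega> \<in> space M. \<bar>S J \<omega> - expectation (S J)\<bar> \<ge> a}"
    using S_moments[OF assms(1)] by (intro finite_measure_mono) auto
  also have "\<dots> \<le> variance (S J) / a\<^sup>2"
    using S_moments[OF assms(1)] assms by (intro Chebyshev_inequality) auto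
  finally show ?thesis
    using S_moments[OF assms(1)] by simp
qed

lemma exp_S_small:
  assumes "finite J" "s \<ge> 0"
  shows "integrable M (\<lambda>\<omega>. exp (s * S J \<omega>) * indicator (small h J) \<omega>)"
    and "expectation (\<lambda>\<omega>. exp (s * S J \<omega>) * indicator (small h J) \<omega>) = mgf_upto s h ^ card J"
proof -
  define f where "f y = exp (s * y) * indicator {..h} y" for y :: real
  have [measurable]: "f \<in> borel_measurable borel"
    unfolding f_def by measurable
  have prod: "(\<Prod>j\<in>J. f (\<xi> j \<omega>)) = exp (s * S J \<omega>) * indicator (small h J) \<omega>" if "\<omega> \<in> space M" for \<omega>
    using assms(1) that
    by (simp add: f_def S_def sum_distrib_left exp_sum prod.distrib small_def indicator_def)
  have ind: "indep_vars (\<lambda>_. borel) (\<lambda>j \<omega>. f (\<xi> j \<omega>)) J"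
    by (rule indep_vars_compose2[OF indep_vars_subset[OF indep]]) auto
  have "\<bar>f y\<bar> \<le> exp (s * h)" for y
    using assms(2) by (auto simp: f_def indicator_def intro: mult_left_mono)
  then have int: "integrable M (\<lambda>\<omega>. f (\<xi> j \<omega>))" for j
    by (intro integrable_const_bound[of _ "exp (s * h)"]) auto
  have "integrable M (\<lambda>\<omega>. \<Prod>j\<in>J. f (\<xi> j \<omega>))"
    by (rule indep_vars_integrable[OF assms(1) ind int])
  then show "integrable M (\<lambda>\<omega>. exp (s * S J \<omega>) * indicator (small h J) \<omega>)"
    by (subst (asm) Bochner_Integration.integrable_cong[OF refl prod])
  have "expectation (\<lambda>\<omega>. exp (s * S J \<omega>) * indicator (small h J) \<omega>) = expectation (\<lambda>\<omega>. \<Prod>j\<in>J. f (\<xi> j \<omega>))"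
    by (rule Bochner_Integration.integral_cong) (simp_all add: prod)
  also have "\<dots> = (\<Prod>j\<in>J. expectation (\<lambda>\<omega>. f (\<xi> j \<omega>)))"
    by (rule indep_vars_lebesgue_integral[OF assms(1) ind int])
  finally show "expectation (\<lambda>\<omega>. exp (s * S J \<omega>) * indicator (small h J) \<omega>) = mgf_upto s h ^ card J"
    by (simp add: expectation_step[of f] mgf_upto_def flip: f_def)
qed

text \<open>The quadratic bound on \<open>exp\<close> holds on the whole negative half-line, so a centred step needs no
  truncation from below.\<close>

lemma mgf_upto_le:
  assumes "s > 0" "e > 0"
  shows "mgf_upto s h \<le> 1 + (1 + e) * s\<^sup>2 / 2 + exp (s * h) * Ftail (ln (1 + e) / s)"
proof -
  define u where "u = ln (1 + e)"
  have "mgf_upto s h \<le>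
      (\<integral>y. 1 + s * y + (1 + e) * s\<^sup>2 / 2 * y\<^sup>2 + exp (s * h) * indicator {u / s<..} y \<partial>F)"
    unfolding mgf_upto_def
  proof (rule integral_mono)
    show "integrable F (\<lambda>y. exp (s * y) * indicator {..h} y)"
      using assms by (intro F.integrable_const_bound[of _ "exp (s * h)"]) (auto simp: indicator_def)
    show "integrable F (\<lambda>y. 1 + s * y + (1 + e) * s\<^sup>2 / 2 * y\<^sup>2 + exp (s * h) * indicator {u / s<..} y)"
      by (intro Bochner_Integration.integrable_add integrable_mult_right F_moments F.integrable_const
          integrable_real_indicator) (auto simp: F.emeasure_eq_measure)
    fix y :: real
    \<comment> \<open>Completing the square shows that the quadratic is nonnegative. It may
      therefore stay in the bound where the integrand vanishes and also beyond \<open>u / s\<close>,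
      where \<open>exp (s * y) \<le> exp (s * h)\<close> does the work.\<close>
    have q: "1 + s * y + (1 + e) * (s * y)\<^sup>2 / 2 \<ge> 0"
    proof -
      have "1 + s * y + (1 + e) * (s * y)\<^sup>2 / 2 = 1 / 2 + (1 + s * y)\<^sup>2 / 2 + e * (s * y)\<^sup>2 / 2"
        by (simp add: power2_eq_square algebra_simps add_divide_distrib)
      then show ?thesis
        using assms by simp
    qed
    have "exp (s * y) * indicator {..h} y \<le> 1 + s * y + (1 + e) * (s * y)\<^sup>2 / 2 + exp (s * h) * indicator {u / s<..} y"
    proof (cases "y \<le> u / s")
      case True
      then have "exp (s * y) \<le> 1 + s * y + (1 + e) * (s * y)\<^sup>2 / 2"
        using assms by (intro exp_le_quadratic) (auto simp: u_def field_simps)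
      with q True show ?thesis
        by (auto simp: indicator_def)
    next
      case False
      then show ?thesis
        using q assms by (auto simp: indicator_def intro: add_increasing)
    qed
    then show "exp (s * y) * indicator {..h} y \<le> 1 + s * y + (1 + e) * s\<^sup>2 / 2 * y\<^sup>2 + exp (s * h) * indicator {u / s<..} y"
      by (simp add: power_mult_distrib)
  qed
  also have "\<dots> = 1 + (1 + e) * s\<^sup>2 / 2 + exp (s * h) * Ftail (u / s)"
  proof -
    have "integrable F (\<lambda>y. s * y)"
      by (rule integrable_mult_right, rule F_moments)
    moreover have "integrable F (\<lambda>y. (1 + e) * s\<^sup>2 / 2 * y\<^sup>2)"
      by (rule integrable_mult_right, rule F_moments)
    moreover have "integrable F (\<lambda>y. exp (s * h) * indicat_real {u / s<..} y)"
      by (intro integrable_mult_right integrable_real_indicator) (auto simp: F.emeasure_eq_measure)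
    moreover have "(\<integral>y. s * y \<partial>F) = 0" "(\<integral>y. (1 + e) * s\<^sup>2 / 2 * y\<^sup>2 \<partial>F) = (1 + e) * s\<^sup>2 / 2"
        "(\<integral>y. exp (s * h) * indicat_real {u / s<..} y \<partial>F) = exp (s * h) * Ftail (u / s)"
        "(\<integral>y. 1 \<partial>F) = (1::real)"
      by (subst integral_mult_right_zero, simp add: F_moments Ftail_def)+ (use F.prob_space in simp)
    ultimately show ?thesis
      by (simp only: Bochner_Integration.integral_add Bochner_Integration.integrable_add F.integrable_const)
  qed
  finally show ?thesis
    by (simp add: u_def)
qed

lemma Ftail_nonneg: "Ftail y \<ge> 0"
  by (simp add: Ftail_def)

lemma Ftail_antimono: "y \<le> z \<Longrightarrow> Ftail z \<le> Ftail y"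
  unfolding Ftail_def by (intro F.finite_measure_mono) auto

lemma mgf_upto_nonneg: "mgf_upto s h \<ge> 0"
  unfolding mgf_upto_def by (intro Bochner_Integration.integral_nonneg) auto

lemma prob_S_small:
  assumes "finite J" "s \<ge> 0"
  shows "prob {\<omega> \<in> small h J. S J \<omega> > x} \<le> exp (- s * x) * mgf_upto s h ^ card J"
proof -
  have [measurable]: "{\<omega> \<in> small h J. S J \<omega> > x} \<in> events"
    using assms unfolding small_def by measurable
  have "prob {\<omega> \<in> small h J. S J \<omega> > x} = expectation (indicator {\<omega> \<in> small h J. S J \<omega> > x})"
    using sets.sets_into_space[OF small_measurable[OF assms(1)]] by (simp add: Int_absorb2 subset_iff)
  also have "\<dots> \<le> expectation (\<lambda>\<omega>. exp (- s * x) * (exp (s * S J \<omega>) * indicator (small h J) \<omega>))"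
  proof (rule integral_mono)
    show "integrable M (indicat_real {\<omega> \<in> small h J. S J \<omega> > x})"
      by (rule integrable_real_indicator) (auto simp: emeasure_eq_measure)
    show "integrable M (\<lambda>\<omega>. exp (- s * x) * (exp (s * S J \<omega>) * indicator (small h J) \<omega>))"
      using exp_S_small[OF assms] by simp
    fix \<omega>
    have "s * x \<le> s * S J \<omega>" if "S J \<omega> > x"
      using that assms by (intro mult_left_mono) auto
    then show "indicator {\<omega> \<in> small h J. S J \<omega> > x} \<omega> \<le> exp (- s * x) * (exp (s * S J \<omega>) * indicator (small h J) \<omega>)"
      by (auto simp: indicator_def exp_minus field_simps)
  qed
  finally show ?thesis
    using exp_S_small[OF assms] by simp
qed

section \<open>Decomposition according to the number of large steps\<close>

lemma prob_two_large:
  assumes "i \<noteq> j"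
  shows "prob {\<omega> \<in> space M. \<xi> i \<omega> > h \<and> \<xi> j \<omega> > h} = (Ftail h)\<^sup>2"
proof -
  have "prob (\<Inter>k\<in>{i, j}. \<xi> k -` {h<..} \<inter> space M) = (\<Prod>k\<in>{i, j}. prob (\<xi> k -` {h<..} \<inter> space M))"
    by (rule indep_varsD[OF indep]) auto
  also have "(\<Inter>k\<in>{i, j}. \<xi> k -` {h<..} \<inter> space M) = {\<omega> \<in> space M. \<xi> i \<omega> > h \<and> \<xi> j \<omega> > h}"
    by auto
  finally have "prob {\<omega> \<in> space M. \<xi> i \<omega> > h \<and> \<xi> j \<omega> > h} = (\<Prod>k\<in>{i, j}. prob (\<xi> k -` {h<..} \<inter> space M))" .
  moreover have "prob (\<xi> k -` {h<..} \<inter> space M) = Ftail h" for k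
    using prob_step[of "{h<..}" k] by (simp add: Ftail_def vimage_def Int_def conj_commute)
  ultimately show ?thesis
    using assms by (simp add: power2_eq_square)
qed

lemma prob_not_small:
  assumes "finite J"
  shows "prob (space M - small h J) \<le> card J * Ftail h"
proof -
  have "prob (space M - small h J) \<le> prob (\<Union>j\<in>J. {\<omega> \<in> space M. \<xi> j \<omega> \<in> {h<..}})"
    using assms by (intro finite_measure_mono) (auto simp: small_def)
  also have "\<dots> \<le> (\<Sum>j\<in>J. prob {\<omega> \<in> space M. \<xi> j \<omega> \<in> {h<..}})"
    using assms by (intro finite_measure_subadditive_finite) auto
  also have "\<dots> = card J * Ftail h"
    using prob_step[of "{h<..}"] by (simp add: Ftail_def)
  finally show ?thesis .
qed

text \<open>The large index \<open>i\<close> and the set \<open>J\<close> of the other steps are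
  separate arguments, so that independence can be used for any \<open>i\<close> outside
  \<open>J\<close>. Requiring all of \<open>J\<close> to be small makes the events for different
  \<open>i\<close> disjoint.\<close>

definition one_big :: "real \<Rightarrow> real \<Rightarrow> ereal \<Rightarrow> nat \<Rightarrow> nat set \<Rightarrow> 'a set" where
  "one_big h x T i J = {\<omega> \<in> small h J. \<xi> i \<omega> > h \<and> \<xi> i \<omega> + S J \<omega> \<in> shift_Delta x T}"

lemma one_big_measurable: "finite J \<Longrightarrow> one_big h x T i J \<in> events"
proof -
  assume [simp]: "finite J"
  have "one_big h x T i J = {\<omega> \<in> space M. (\<forall>j\<in>J. \<xi> j \<omega> \<le> h) \<and> \<xi> i \<omega> > h \<and>
      x < \<xi> i \<omega> + S J \<omega> \<and> ereal (\<xi> i \<omega> + S J \<omega> - x) \<le> T}"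
    by (auto simp: one_big_def small_def shift_Delta_eq)
  also have "\<dots> \<in> events"
    by measurable
  finally show ?thesis .
qed

text \<open>The event involves the other steps through their sum and through their individual sizes.
  Hence the conditioning is on the whole vector of steps in \<open>J\<close>, as an element of a
  product space, and not just on \<open>S J\<close>.\<close>

lemma prob_one_big:
  assumes "finite J" "i \<notin> J"
  shows "prob (one_big h x T i J) = expectation
      (\<lambda>\<omega>. measure F (shift_Delta (x - S J \<omega>) T \<inter> {h<..}) * indicator (small h J) \<omega>)"
    and "(\<lambda>\<omega>. measure F (shift_Delta (x - S J \<omega>) T \<inter> {h<..}) * indicator (small h J) \<omega>) \<in> borel_measurable M"
proof -
  define N where "N J = PiM J (\<lambda>_. borel :: real measure)" for J :: "nat set"
  define V where "V J \<omega> = restrict (\<lambda>j. \<xi> j \<omega>) J" for J \<omega>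
  define A where "A = {zv \<in> space (N {i} \<Otimes>\<^sub>M N J). (\<forall>j\<in>J. snd zv j \<le> h) \<and> fst zv i > h \<and>
      x < fst zv i + (\<Sum>j\<in>J. snd zv j) \<and> ereal (fst zv i + (\<Sum>j\<in>J. snd zv j) - x) \<le> T}"
  have A: "A \<in> sets (N {i} \<Otimes>\<^sub>M N J)"
    unfolding A_def N_def using assms(1) by measurable
  have ind: "indep_var (N {i}) (V {i}) (N J) (V J)"
    unfolding N_def V_def using assms(2) by (intro indep_var_restrict[OF indep]) auto
  have [measurable]: "V K \<in> measurable M (N K)" for K
    unfolding V_def N_def by measurable
  have V: "(\<Sum>j\<in>J. V J \<omega> j) = S J \<omega>" "(\<forall>j\<in>J. V J \<omega> j \<le> h) \<longleftrightarrow> (\<forall>j\<in>J. \<xi> j \<omega> \<le> h)"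
      "V {i} \<omega> i = \<xi> i \<omega>" "V K \<omega> \<in> space (N K)" for \<omega> K
    by (auto simp: V_def N_def S_def space_PiM)
  have eq: "measure (distr M (N {i}) (V {i})) {z \<in> space (N {i}). (z, V J \<omega>) \<in> A} =
      measure F (shift_Delta (x - S J \<omega>) T \<inter> {h<..}) * indicator (small h J) \<omega>" if w: "\<omega> \<in> space M" for \<omega>
  proof (cases "\<omega> \<in> small h J")
    case True
    have B: "shift_Delta (x - S J \<omega>) T \<inter> {h<..} \<in> sets borel"
      unfolding shift_Delta_eq by measurable
    have Z: "{z \<in> space (N {i}). (z, V J \<omega>) \<in> A} = {z \<in> space (N {i}). z i \<in> shift_Delta (x - S J \<omega>) T \<inter> {h<..}}"
      using V w True unfolding A_def shift_Delta_eq
      by (auto simp: space_pair_measure small_def algebra_simps)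
    have "{z \<in> space (N {i}). z i \<in> shift_Delta (x - S J \<omega>) T \<inter> {h<..}} \<in> sets (N {i})"
      using B unfolding N_def by measurable
    then have "measure (distr M (N {i}) (V {i})) {z \<in> space (N {i}). (z, V J \<omega>) \<in> A} =
        prob {\<omega>' \<in> space M. \<xi> i \<omega>' \<in> shift_Delta (x - S J \<omega>) T \<inter> {h<..}}"
      unfolding Z using V by (subst measure_distr) (auto intro!: arg_cong[where f=prob])
    then show ?thesis
      using True prob_step[OF B] by simp
  next
    case False
    then have "{z \<in> space (N {i}). (z, V J \<omega>) \<in> A} = {}"
      using V w by (auto simp: A_def small_def)
    then have "measure (distr M (N {i}) (V {i})) {z \<in> space (N {i}). (z, V J \<omega>) \<in> A} = 0"
      by (simp only: measure_empty)
    then show ?thesis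
      using False by simp
  qed
  have "one_big h x T i J = {\<omega> \<in> space M. (V {i} \<omega>, V J \<omega>) \<in> A}"
    using V by (auto simp: one_big_def A_def small_def shift_Delta_eq space_pair_measure)
  then have "prob (one_big h x T i J) =
      expectation (\<lambda>\<omega>. measure (distr M (N {i}) (V {i})) {z \<in> space (N {i}). (z, V J \<omega>) \<in> A})"
    using prob_indep_pair(1)[OF ind A] by simp
  also have "\<dots> = expectation
      (\<lambda>\<omega>. measure F (shift_Delta (x - S J \<omega>) T \<inter> {h<..}) * indicator (small h J) \<omega>)"
    by (rule Bochner_Integration.integral_cong) (simp_all only: eq)
  finally show "prob (one_big h x T i J) = expectation
      (\<lambda>\<omega>. measure F (shift_Delta (x - S J \<omega>) T \<inter> {h<..}) * indicator (small h J) \<omega>)" .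
  show "(\<lambda>\<omega>. measure F (shift_Delta (x - S J \<omega>) T \<inter> {h<..}) * indicator (small h J) \<omega>) \<in> borel_measurable M"
    using prob_indep_pair(2)[OF ind A] by (subst (asm) measurable_cong[OF eq])
qed

text \<open>Either no step exceeds \<open>h\<close>, or exactly one does, or some ordered pair does,
  and there are at most \<open>n * n\<close> such pairs. The events with exactly one large step are
  disjoint and contained in \<open>E\<close>, so the same sum is also a lower bound.\<close>

lemma big_jump_decomposition:
  fixes n :: nat and x h :: real and T :: ereal
  defines "I \<equiv> {1..n}"
  defines "E \<equiv> {\<omega> \<in> space M. S I \<omega> \<in> shift_Delta x T}"
  shows "prob E \<le> prob {\<omega> \<in> small h I. S I \<omega> > x} + (\<Sum>i\<in>I. prob (one_big h x T i (I - {i}))) + (real n * Ftail h)\<^sup>2"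
    and "(\<Sum>i\<in>I. prob (one_big h x T i (I - {i}))) \<le> prob E"
proof -
  have I: "finite I" "card I = n"
    by (auto simp: I_def)
  have Ssplit: "\<xi> i \<omega> + S (I - {i}) \<omega> = S I \<omega>" if "i \<in> I" for i \<omega>
    using that I by (simp add: S_def sum.remove)
  define A where "A = {\<omega> \<in> small h I. S I \<omega> > x}"
  define B where "B = (\<Union>i\<in>I. one_big h x T i (I - {i}))"
  define C where "C = (\<Union>(i, j)\<in>{(i, j) \<in> I \<times> I. i \<noteq> j}. {\<omega> \<in> space M. \<xi> i \<omega> > h \<and> \<xi> j \<omega> > h})"
  have E [measurable]: "E \<in> events"
    unfolding E_def shift_Delta_eq mem_Collect_eq by measurable
  have A [measurable]: "A \<in> events"
    unfolding A_def small_def using I by measurable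
  have B [measurable]: "B \<in> events"
    unfolding B_def using I by (auto intro!: one_big_measurable)
  have P: "finite {(i, j) \<in> I \<times> I. i \<noteq> j}" "card {(i, j) \<in> I \<times> I. i \<noteq> j} \<le> n * n"
    using I card_mono[of "I \<times> I" "{(i, j) \<in> I \<times> I. i \<noteq> j}"]
    by (auto intro: finite_subset[of _ "I \<times> I"] simp: card_cartesian_product)
  have C [measurable]: "C \<in> events"
    unfolding C_def using P by (intro sets.finite_UN) auto
  have "E \<subseteq> (A \<union> B) \<union> C"
  proof
    fix \<omega> assume w: "\<omega> \<in> E"
    then have sp: "\<omega> \<in> space M" and Sx: "S I \<omega> \<in> shift_Delta x T" "S I \<omega> > x"
      by (auto simp: E_def shift_Delta_eq)
    show "\<omega> \<in> (A \<union> B) \<union> C"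
    proof (cases "\<omega> \<in> small h I")
      case True
      then show ?thesis
        using Sx by (simp add: A_def)
    next
      case False
      then obtain i where i: "i \<in> I" "\<xi> i \<omega> > h"
        using sp by (auto simp: small_def not_le)
      show ?thesis
      proof (cases "\<omega> \<in> small h (I - {i})")
        case True
        then have "\<omega> \<in> one_big h x T i (I - {i})"
          using i Sx Ssplit[OF i(1)] by (simp add: one_big_def)
        then show ?thesis
          using i by (auto simp: B_def)
      next
        case False
        then obtain j where "j \<in> I - {i}" "\<xi> j \<omega> > h"
          using sp by (auto simp: small_def not_le)
        then show ?thesis
          using i sp by (auto simp: C_def)
      qed
    qed
  qed
  then have "prob E \<le> prob ((A \<union> B) \<union> C)"
    by (intro finite_measure_mono) auto
  also have "\<dots> \<le> prob (A \<union> B) + prob C"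
    by (intro measure_Un_le) auto
  also have "prob (A \<union> B) \<le> prob A + prob B"
    by (intro measure_Un_le) auto
  also have "prob B = (\<Sum>i\<in>I. prob (one_big h x T i (I - {i})))"
    unfolding B_def using I
  proof (intro finite_measure_finite_Union)
    show "disjoint_family_on (\<lambda>i. one_big h x T i (I - {i})) I"
      unfolding disjoint_family_on_def one_big_def small_def by force
  qed (auto intro: one_big_measurable)
  also have "prob C \<le> (\<Sum>(i, j)\<in>{(i, j) \<in> I \<times> I. i \<noteq> j}. prob {\<omega> \<in> space M. \<xi> i \<omega> > h \<and> \<xi> j \<omega> > h})"
    unfolding C_def using finite_measure_subadditive_finite[OF P(1), of "\<lambda>(i, j). {\<omega> \<in> space M. \<xi> i \<omega> > h \<and> \<xi> j \<omega> > h}"]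
    by (simp add: case_prod_unfold image_subset_iff)
  also have "\<dots> = (\<Sum>(i, j)\<in>{(i, j) \<in> I \<times> I. i \<noteq> j}. (Ftail h)\<^sup>2)"
    by (rule sum.cong) (auto simp: prob_two_large)
  also have "\<dots> = real (card {(i, j) \<in> I \<times> I. i \<noteq> j}) * (Ftail h)\<^sup>2"
    by (simp add: case_prod_unfold)
  also have "\<dots> \<le> real (n * n) * (Ftail h)\<^sup>2"
    using P(2) by (intro mult_right_mono) (auto simp del: of_nat_mult)
  also have "real (n * n) * (Ftail h)\<^sup>2 = (real n * Ftail h)\<^sup>2"
    by (simp add: power_mult_distrib power2_eq_square)
  finally show "prob E \<le> prob {\<omega> \<in> small h I. S I \<omega> > x} + (\<Sum>i\<in>I. prob (one_big h x T i (I - {i}))) + (real n * Ftail h)\<^sup>2"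
    by (simp add: A_def)
  have "B \<subseteq> E"
    using Ssplit by (auto simp: B_def E_def one_big_def small_def)
  then have "prob B \<le> prob E"
    by (intro finite_measure_mono) auto
  then show "(\<Sum>i\<in>I. prob (one_big h x T i (I - {i}))) \<le> prob E"
    using \<open>prob B = (\<Sum>i\<in>I. prob (one_big h x T i (I - {i})))\<close> by simp
qed

end

section \<open>The single big jump\<close>

text \<open>AM-GM in place of the Cauchy--Schwarz inequality: integrated against the law of the sum of the
  small steps, the right-hand side needs only a moment generating function and Chebyshev.\<close>

lemma exp_ratio_le:
  fixes a b y K :: real
  assumes "K > 0"
  shows "exp (b * max y 0) * indicator A y \<le> (1 + exp (2 * b * y)) / (2 * K) + K / 2 * indicator A y"
proof (cases "y \<in> A")
  case True
  define z where "z = exp (b * max y 0)"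
  have "0 \<le> (z / K - 1)\<^sup>2 * K / 2"
    using assms by simp
  also have "\<dots> = z\<^sup>2 / (2 * K) + K / 2 - z"
    using assms by (simp add: power2_eq_square field_simps)
  finally have "z \<le> z\<^sup>2 / (2 * K) + K / 2"
    by simp
  also have "z\<^sup>2 = exp (2 * b * max y 0)"
    by (simp add: z_def power2_eq_square flip: exp_add)
  also have "\<dots> \<le> 1 + exp (2 * b * y)"
    by (simp add: max_def)
  finally show ?thesis
    using True assms by (simp add: z_def divide_right_mono)
qed (use assms in \<open>simp add: add_nonneg_nonneg\<close>)

locale heavy_walk = iid_walk M \<xi> F + lognormal_weight p g c \<beta>
  for M :: "'a measure" and \<xi> F p g c \<beta> +
  fixes T :: ereal
  assumes T: "0 < T" and g_F: "g x = measure F (shift_Delta x T)"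
begin

section \<open>Comparison of the tail of \<open>F\<close> with \<open>g\<close>\<close>

lemma g_nonneg: "g x \<ge> 0"
  by (simp add: g_F)

lemma exp_Q_le: "d > 0 \<Longrightarrow> a > 0 \<Longrightarrow> \<forall>\<^sub>F x in at_top. exp (- d * Q x) \<le> a / x ^ k"
proof -
  assume d: "d > 0" and a: "a > 0"
  have "\<forall>\<^sub>F x in at_top. - ln a + real k * ln x \<le> d * Q x" "\<forall>\<^sub>F x::real in at_top. x > 0"
    using Q_dominates_ln[OF d, of "- ln a" "real k"] eventually_gt_at_top by auto
  then show ?thesis
  proof eventually_elim
    case (elim x)
    then have "exp (- d * Q x) \<le> exp (ln (a / x ^ k))"
      using a by (simp add: ln_div ln_realpow)
    then show ?case
      using elim a by simp
  qed
qed

lemma Q_ge_1: "\<forall>\<^sub>F x in at_top. Q x \<ge> 1"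
  using Q_dominates_ln[of 1 1 0] by simp

text \<open>A crude bound whose purpose is to make the remainder of the telescoping sum below
  vanish.\<close>

lemma Ftail_Chebyshev: "a > 0 \<Longrightarrow> Ftail a \<le> 1 / a\<^sup>2"
proof -
  assume a: "a > 0"
  have "Ftail a = prob {\<omega> \<in> space M. \<xi> 0 \<omega> \<in> {a<..}}"
    by (subst prob_step) (simp_all add: Ftail_def)
  also have "\<dots> \<le> prob {\<omega> \<in> space M. \<bar>S {0} \<omega>\<bar> > a}"
    by (intro finite_measure_mono) (auto simp: S_def)
  also have "\<dots> \<le> 1 / a\<^sup>2"
    using S_Chebyshev[of "{0}" a] a by simp
  finally show ?thesis .
qed

text \<open>For infinite \<open>T\<close> the tail is \<open>g\<close> itself. For finite
  \<open>T\<close> it is a sum of values of \<open>g\<close> at spacing \<tau>. Half of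
  \<open>e\<close> is sacrificed to produce the summable factor \<open>\<tau> / z^2\<close>, at most
  \<open>1 / (z - \<tau>) - 1 / z\<close>; starting beyond \<open>\<tau> + 1\<close> makes the total
  at most 1.\<close>

lemma Ftail_le:
  assumes "e > 0"
  shows "\<forall>\<^sub>F x in at_top. Ftail x \<le> exp (- (1 - e) * Q x)"
proof (cases T)
  case PInf
  then have "Ftail x = g x" for x
    by (simp add: Ftail_def g_F shift_Delta_eq greaterThan_def)
  then show ?thesis
    using g_bounds[OF assms] by (auto elim: eventually_mono)
next
  case (real \<tau>)
  then have \<tau>: "\<tau> > 0"
    using T by simp
  have sh: "shift_Delta x T = {x<..x + \<tau>}" for x
    by (auto simp: shift_Delta_eq real)
  show ?thesis
  proof (cases "e < 1")
    case False
    have "Ftail x \<le> exp (- (1 - e) * Q x)" for x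
    proof -
      have "Ftail x \<le> 1"
        by (simp add: Ftail_def)
      also have "1 \<le> exp (- (1 - e) * Q x)"
        using False Q_nonneg by simp
      finally show ?thesis .
    qed
    then show ?thesis
      by simp
  next
    case e: True
    have "\<forall>\<^sub>F x in at_top. g x \<le> exp (- (1 - e / 2) * Q x) \<and> exp (- (e / 2) * Q x) \<le> \<tau> / x\<^sup>2"
      using g_bounds[of "e / 2"] exp_Q_le[of "e / 2" \<tau> 2] assms \<tau> by (auto intro: eventually_elim2)
    then obtain X where X: "\<And>x. x \<ge> X \<Longrightarrow> g x \<le> exp (- (1 - e / 2) * Q x)"
        "\<And>x. x \<ge> X \<Longrightarrow> exp (- (e / 2) * Q x) \<le> \<tau> / x\<^sup>2"
      unfolding eventually_at_top_linorder by blast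
    have "Ftail x \<le> exp (- (1 - e) * Q x)" if x: "x \<ge> max (max X 1) (\<tau> + 1)" for x
    proof -
      define A where "A = exp (- (1 - e) * Q x)"
      have A: "A > 0"
        by (simp add: A_def)
      \<comment> \<open>summing \<open>g\<close> over the translates \<open>x + k \<tau>\<close> telescopes\<close>
      have g_le: "g z \<le> A * (1 / (z - \<tau>) - 1 / z)" if z: "z \<ge> x" for z
      proof -
        have "g z \<le> exp (- (1 - e) * Q z) * exp (- (e / 2) * Q z)"
          using X(1)[of z] x z by (simp flip: exp_add) (simp add: algebra_simps)
        also have "\<dots> \<le> A * (\<tau> / z\<^sup>2)"
        proof (intro mult_mono)
          have "(1 - e) * Q x \<le> (1 - e) * Q z"
            using e x z by (intro mult_left_mono Q_mono) auto
          then show "exp (- (1 - e) * Q z) \<le> A"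
            by (simp only: A_def exp_le_cancel_iff mult_minus_left neg_le_iff_le)
        qed (use X(2)[of z] x z A in auto)
        also have "\<dots> \<le> A * (\<tau> / (z * (z - \<tau>)))"
          using A \<tau> x z by (intro mult_left_mono divide_left_mono) (auto simp: power2_eq_square)
        also have "\<tau> / (z * (z - \<tau>)) = 1 / (z - \<tau>) - 1 / z"
          using \<tau> x z by (simp add: field_simps)
        finally show ?thesis .
      qed
      have step: "Ftail z = g z + Ftail (z + \<tau>)" for z
      proof -
        have "measure F ({z<..z + \<tau>} \<union> {z + \<tau><..}) = measure F {z<..z + \<tau>} + measure F {z + \<tau><..}"
          by (rule F.finite_measure_Union) auto
        moreover have "{z<..z + \<tau>} \<union> {z + \<tau><..} = {z<..}"
          using \<tau> by auto
        ultimately show ?thesis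
          by (simp add: Ftail_def g_F sh)
      qed
      have iter: "Ftail x \<le> Ftail (x + real N * \<tau>) + A * (1 / (x - \<tau>) - 1 / (x + real N * \<tau> - \<tau>))" for N
      proof (induction N)
        case (Suc N)
        define y where "y = x + real N * \<tau>"
        have "y \<ge> x"
          using \<tau> by (simp add: y_def)
        from g_le[OF this] have "g y \<le> A * (1 / (y - \<tau>)) - A * (1 / y)"
          by (simp add: right_diff_distrib)
        moreover have "Ftail x \<le> Ftail y + (A * (1 / (x - \<tau>)) - A * (1 / (y - \<tau>)))"
          using Suc by (simp only: y_def right_diff_distrib)
        ultimately have "Ftail x \<le> Ftail (y + \<tau>) + (A * (1 / (x - \<tau>)) - A * (1 / y))"
          using step[of y] by linarith
        moreover have "x + real (Suc N) * \<tau> = y + \<tau>"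
          by (simp add: y_def algebra_simps)
        ultimately show ?case
          by (simp only: right_diff_distrib add_diff_cancel_right')
      qed simp
      have "Ftail x \<le> 1 / (x + real N * \<tau>)\<^sup>2 + A / (x - \<tau>)" for N
      proof -
        have "x + real N * \<tau> \<ge> x"
          using \<tau> by simp
        then have pos: "x + real N * \<tau> - \<tau> > 0" "x + real N * \<tau> > 0"
          using x by auto
        then have "A * (1 / (x - \<tau>) - 1 / (x + real N * \<tau> - \<tau>)) \<le> A / (x - \<tau>)"
          using A by (simp add: right_diff_distrib)
        then show ?thesis
          using iter[of N] Ftail_Chebyshev[OF pos(2)] by linarith
      qed
      moreover have "(\<lambda>N. 1 / (x + real N * \<tau>)\<^sup>2 + A / (x - \<tau>)) \<longlonglongrightarrow> 0 + A / (x - \<tau>)"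
      proof (rule tendsto_add[OF _ tendsto_const])
        show "(\<lambda>N. 1 / (x + real N * \<tau>)\<^sup>2) \<longlonglongrightarrow> 0"
          using \<tau> by real_asymp
      qed
      ultimately have "Ftail x \<le> 0 + A / (x - \<tau>)"
        by (intro LIMSEQ_le_const) auto
      also have "\<dots> \<le> A"
        using x A by (simp add: divide_le_eq)
      finally show ?thesis
        by (simp add: A_def)
    qed
    then show ?thesis
      unfolding eventually_at_top_linorder by blast
  qed
next
  case MInf
  then show ?thesis
    using T by simp
qed

text \<open>Dividing \<open>x\<close> by a power of its logarithm leaves it above
  \<open>x powr r\<close> for every \<open>r < 1\<close>, and
  \<open>Q (x powr r) = r powr \<beta> * Q x\<close>. So the loss in the exponent can be made as
  small as desired.\<close>

lemma Ftail_below: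
  assumes "\<kappa> > 0" "b \<ge> 0"
  shows "\<forall>\<^sub>F x in at_top. Ftail (\<kappa> * x / ln x powr b) \<le> exp (- (3 / 4) * Q x)"
proof -
  \<comment> \<open>Solves \<open>r * r powr \<beta> = 3 / 4\<close>: one factor \<open>r\<close> is
    lost in the tail bound with \<open>e = 1 - r\<close>, the other in passing from
    \<open>Q (x powr r)\<close> to \<open>Q x\<close>.\<close>
  define r where "r = (3 / 4 :: real) powr (1 / (\<beta> + 1))"
  have r: "0 < r" "r < 1" and r34: "r * r powr \<beta> = 3 / 4"
  proof -
    show "0 < r"
      by (simp add: r_def)
    show "r < 1"
      unfolding r_def using powr_less_mono2[of "1 / (\<beta> + 1)" "3 / 4" 1] \<beta> by simp
    have "r * r powr \<beta> = r powr (1 + \<beta>)"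
      using \<open>0 < r\<close> by (simp add: powr_add)
    also have "\<dots> = 3 / 4"
      using \<beta> by (simp add: r_def powr_powr add.commute)
    finally show "r * r powr \<beta> = 3 / 4" .
  qed
  have "filterlim (\<lambda>x::real. x powr r) at_top at_top"
    using r by real_asymp
  from eventually_compose_filterlim[OF Ftail_le[of "1 - r"] this]
  have "\<forall>\<^sub>F x in at_top. Ftail (x powr r) \<le> exp (- r * Q (x powr r))"
    using r by simp
  moreover have "filterlim (\<lambda>x. (\<kappa> * x / ln x powr b) / x powr r) at_top at_top"
    using assms r by real_asymp
  then have "\<forall>\<^sub>F x in at_top. (\<kappa> * x / ln x powr b) / x powr r \<ge> 1"
    by (simp add: filterlim_at_top)
  moreover have "\<forall>\<^sub>F x::real in at_top. x > 1"
    by (rule eventually_gt_at_top)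
  ultimately show ?thesis
  proof eventually_elim
    case (elim x)
    have "x powr r \<le> \<kappa> * x / ln x powr b"
      using elim by (simp add: le_divide_eq mult.commute)
    then have "Ftail (\<kappa> * x / ln x powr b) \<le> Ftail (x powr r)"
      by (rule Ftail_antimono)
    also have "Q (x powr r) = r powr \<beta> * Q x"
      using elim r by (simp add: Q_def ln_powr powr_mult)
    with elim(1) have "Ftail (x powr r) \<le> exp (- (r * r powr \<beta>) * Q x)"
      by (simp add: algebra_simps)
    finally show ?case
      by (simp add: r34)
  qed
qed

lemma Ftail_quarter: "\<forall>\<^sub>F x in at_top. Ftail (x / 4) \<le> exp (- (3 / 4) * Q x)"
proof -
  have "\<forall>\<^sub>F x in at_top. Ftail (1 / 4 * x / ln x powr 0) \<le> exp (- (3 / 4) * Q x)"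
    by (rule Ftail_below) auto
  then show ?thesis
    using eventually_gt_at_top[of 1] by eventually_elim simp
qed

text \<open>Chernoff with \<open>s = 2 Q(x) / x\<close>: the exponent is
  \<open>- 2 Q + (1 + o(1)) (s\<^sup>2 / 2) n = - 2 Q (1 - (1 + o(1)) n Q / x\<^sup>2)\<close>, which is below
  \<open>- (1 + 2 d) Q\<close> exactly because \<open>\<rho> < 1 / 2\<close>.\<close>

lemma no_big_jump:
  assumes "\<rho> < 1 / 2" "e > 0"
  shows "\<forall>\<^sub>F x in at_top. \<forall>n. real n * Q x \<le> \<rho> * x\<^sup>2 \<longrightarrow>
    prob {\<omega> \<in> small (x / 4) {1..n}. S {1..n} \<omega> > x} \<le> e * g x"
proof -
  \<comment> \<open>\<open>a\<close> is used twice, for the quadratic bound and for the tail term,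
    hence \<open>1 + 2 * a\<close>. Both constants are tuned to
    \<open>2 * \<rho> * (1 + 2 * a) \<le> 1 - 2 * d\<close>; the surplus \<open>2 * d\<close> is
    split between the factor \<open>e\<close> and the lower bound for \<open>g\<close>.\<close>
  define d where "d = (1 / 2 - \<rho>) / 2"
  define a where "a = (1 - 2 * \<rho>) / 4"
  have d: "d > 0" and a: "a > 0"
    using assms by (auto simp: d_def a_def)
  have ra: "2 * \<rho> * (1 + 2 * a) \<le> 1 - 2 * d"
  proof -
    define q where "q = \<rho> * (1 - 2 * \<rho>)"
    have "q \<le> 1 / 2 * (1 - 2 * \<rho>)"
      unfolding q_def using assms by (intro mult_right_mono) auto
    moreover have eq: "2 * \<rho> * (1 + 2 * a) = 2 * \<rho> + q" "1 - 2 * d = 1 / 2 + \<rho>"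
      by (simp_all add: a_def q_def d_def field_simps)
    ultimately show ?thesis
      unfolding eq by simp
  qed
  have k: "ln (1 + a) / (2 * c) > 0"
    using a c by simp
  have "\<forall>\<^sub>F x in at_top. Ftail (ln (1 + a) / (2 * c) * x / ln x powr \<beta>) \<le> exp (- (3 / 4) * Q x)"
    using Ftail_below[OF k, of \<beta>] \<beta> by simp
  moreover have "\<forall>\<^sub>F x in at_top. exp (- (1 / 4) * Q x) \<le> (2 * a) / x ^ 2"
    using exp_Q_le[of "1 / 4" "2 * a" 2] a by simp
  moreover have "\<forall>\<^sub>F x in at_top. exp (- d * Q x) \<le> e / x ^ 0"
    using exp_Q_le d assms by blast
  moreover have "\<forall>\<^sub>F x in at_top. exp (- (1 + d) * Q x) \<le> g x"
    using g_bounds[OF d] by (auto elim: eventually_mono)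
  moreover have "\<forall>\<^sub>F x::real in at_top. x > 1"
    by (rule eventually_gt_at_top)
  ultimately show ?thesis
    using Q_ge_1
  proof eventually_elim
    case (elim x)
    define s where "s = 2 * Q x / x"
    have s: "s > 0"
      using elim by (simp add: s_def)
    have us: "ln (1 + a) / s = ln (1 + a) / (2 * c) * x / ln x powr \<beta>"
      using elim c by (simp add: s_def Q_def field_simps)
    have "exp (s * (x / 4)) * Ftail (ln (1 + a) / s) \<le> exp (Q x / 2) * exp (- (3 / 4) * Q x)"
      unfolding us using elim by (intro mult_mono) (auto simp: s_def Ftail_nonneg)
    also have "\<dots> = exp (- (1 / 4) * Q x)"
      by (simp flip: exp_add)
    also have "\<dots> \<le> 2 * a / x\<^sup>2"
      using elim by simp
    \<comment> \<open>Inserting \<open>(Q x)^2 \<ge> 1\<close> brings the tail term to the form of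
      the quadratic term, with \<open>s = 2 * Q x / x\<close>.\<close>
    also have "\<dots> \<le> 2 * a / x\<^sup>2 * (Q x)\<^sup>2"
      using elim a mult_left_mono[of 1 "(Q x)\<^sup>2" "2 * a / x\<^sup>2"] by simp
    also have "\<dots> = a * s\<^sup>2 / 2"
      by (simp add: s_def power_divide power_mult_distrib)
    finally have "mgf_upto s (x / 4) \<le> 1 + (1 + 2 * a) * s\<^sup>2 / 2"
      using mgf_upto_le[OF s a, of "x / 4"] by (simp add: algebra_simps add_divide_distrib)
    also have "\<dots> \<le> exp ((1 + 2 * a) * s\<^sup>2 / 2)"
      by (rule exp_ge_add_one_self)
    finally have mg: "mgf_upto s (x / 4) \<le> exp ((1 + 2 * a) * s\<^sup>2 / 2)" .
    show ?case
    proof (intro allI impI)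
      fix n assume n: "real n * Q x \<le> \<rho> * x\<^sup>2"
      have "mgf_upto s (x / 4) ^ n \<le> exp ((1 + 2 * a) * s\<^sup>2 / 2) ^ n"
        using mg mgf_upto_nonneg by (rule power_mono)
      also have "\<dots> = exp ((1 + 2 * a) * 2 * Q x * (real n * Q x) / x\<^sup>2)"
        by (simp add: s_def power2_eq_square flip: exp_of_nat_mult)
      also have "\<dots> \<le> exp ((1 + 2 * a) * 2 * Q x * (\<rho> * x\<^sup>2) / x\<^sup>2)"
        unfolding exp_le_cancel_iff using n a Q_nonneg[of x]
        by (intro divide_right_mono mult_left_mono) auto
      also have "\<dots> = exp (2 * \<rho> * (1 + 2 * a) * Q x)"
        using elim by simp
      also have "\<dots> \<le> exp ((1 - 2 * d) * Q x)"
        unfolding exp_le_cancel_iff using ra Q_nonneg[of x] by (intro mult_right_mono) auto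
      finally have mgn: "mgf_upto s (x / 4) ^ n \<le> exp ((1 - 2 * d) * Q x)" .
      have "prob {\<omega> \<in> small (x / 4) {1..n}. S {1..n} \<omega> > x} \<le> exp (- s * x) * mgf_upto s (x / 4) ^ n"
        using prob_S_small[of "{1..n}" s "x / 4" x] s by simp
      also have "\<dots> \<le> exp (- s * x) * exp ((1 - 2 * d) * Q x)"
        using mgn by simp
      also have "\<dots> = exp (- d * Q x) * exp (- (1 + d) * Q x)"
        using elim by (simp add: s_def flip: exp_add) (simp add: algebra_simps)
      also have "\<dots> \<le> e * g x"
        using elim assms by (intro mult_mono) auto
      finally show "prob {\<omega> \<in> small (x / 4) {1..n}. S {1..n} \<omega> > x} \<le> e * g x" .
    qed
  qed
qed

text \<open>At this smaller parameter \<open>s * x / 4\<close> is of order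
  \<open>ln x powr (\<beta> - 1)\<close>, negligible against \<open>Q\<close>. One factor is thus at
  most \<open>1 + (D^2 + 1) * (lam x)^2\<close>, where \<open>D^2\<close> comes from the quadratic
  bound with \<open>e = 1\<close> and the extra 1 from the tail term, and \<eta> is chosen so that
  \<open>n\<close> factors give at most \<open>exp (ln 2)\<close>.\<close>

lemma mgf_bulk_bounded:
  assumes "D > 0"
  shows "\<exists>\<eta>>0. \<forall>\<^sub>F x in at_top. \<forall>n. real n * (lam x)\<^sup>2 \<le> \<eta> \<longrightarrow> mgf_upto (D * lam x) (x / 4) ^ n \<le> 2"
proof -
  define \<eta> where "\<eta> = ln 2 / (D\<^sup>2 + 1)"
  have \<eta>: "\<eta> > 0"
    by (simp add: \<eta>_def add_nonneg_pos)
  have k: "ln 2 / D > 0"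
    using assms by simp
  have "\<forall>\<^sub>F x in at_top. Ftail (ln 2 / D * x / ln x powr (\<beta> - 1)) \<le> exp (- (3 / 4) * Q x)"
    using Ftail_below[OF k, of "\<beta> - 1"] \<beta> by simp
  moreover have "((\<lambda>x. (D / 4 * ln x powr (\<beta> - 1)) / (ln x powr \<beta>)) \<longlongrightarrow> 0) at_top"
    using \<beta> by real_asymp
  then have "\<forall>\<^sub>F x in at_top. (D / 4 * ln x powr (\<beta> - 1)) / (ln x powr \<beta>) < c / 2"
    by (rule order_tendstoD) (use c in simp)
  moreover have "\<forall>\<^sub>F x in at_top. exp (- (1 / 4) * Q x) \<le> 1 / x ^ 2"
    using exp_Q_le[of "1 / 4" 1 2] by simp
  moreover have "\<forall>\<^sub>F x::real in at_top. x \<ge> exp 1"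
    by (rule eventually_ge_at_top)
  ultimately have "\<forall>\<^sub>F x in at_top. \<forall>n. real n * (lam x)\<^sup>2 \<le> \<eta> \<longrightarrow> mgf_upto (D * lam x) (x / 4) ^ n \<le> 2"
  proof eventually_elim
    case (elim x)
    have x: "x > 1"
      using elim exp_ge_add_one_self[of 1] by linarith
    define s where "s = D * lam x"
    have s: "s > 0"
      using assms lam_pos[OF x] by (simp add: s_def)
    have us: "ln (1 + 1) / s = ln 2 / D * x / ln x powr (\<beta> - 1)"
      by (simp add: s_def lam_def)
    have "D / 4 * ln x powr (\<beta> - 1) \<le> Q x / 2"
      using elim(2) x by (simp add: Q_def field_simps)
    then have "exp (s * (x / 4)) * Ftail (ln (1 + 1) / s) \<le> exp (Q x / 2) * exp (- (3 / 4) * Q x)"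
      unfolding us using elim x by (intro mult_mono) (auto simp: s_def lam_def Ftail_nonneg)
    also have "\<dots> = exp (- (1 / 4) * Q x)"
      by (simp flip: exp_add)
    also have "\<dots> \<le> (1 / x)\<^sup>2"
      using elim by (simp add: power_divide)
    also have "\<dots> \<le> (lam x)\<^sup>2"
      using lam_ge[of x] elim x by (intro power_mono) auto
    finally have "mgf_upto s (x / 4) \<le> 1 + (D\<^sup>2 + 1) * (lam x)\<^sup>2"
      using mgf_upto_le[OF s, of 1 "x / 4"] by (simp add: s_def power_mult_distrib algebra_simps)
    also have "\<dots> \<le> exp ((D\<^sup>2 + 1) * (lam x)\<^sup>2)"
      by (rule exp_ge_add_one_self)
    finally have mg: "mgf_upto s (x / 4) \<le> exp ((D\<^sup>2 + 1) * (lam x)\<^sup>2)" .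
    show ?case
    proof (intro allI impI)
      fix n assume n: "real n * (lam x)\<^sup>2 \<le> \<eta>"
      have "mgf_upto s (x / 4) ^ n \<le> exp ((D\<^sup>2 + 1) * (lam x)\<^sup>2) ^ n"
        using mg mgf_upto_nonneg by (rule power_mono)
      also have "\<dots> = exp ((D\<^sup>2 + 1) * (real n * (lam x)\<^sup>2))"
        by (simp add: mult.left_commute flip: exp_of_nat_mult)
      also have "\<dots> \<le> exp ((D\<^sup>2 + 1) * \<eta>)"
        unfolding exp_le_cancel_iff using n by (intro mult_left_mono) auto
      also have "(D\<^sup>2 + 1) * \<eta> = ln 2"
        using add_nonneg_pos[of "D\<^sup>2" 1] by (simp add: \<eta>_def)
      finally show "mgf_upto (D * lam x) (x / 4) ^ n \<le> 2"
        by (simp add: s_def)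
    qed
  qed
  then show ?thesis
    using \<eta> by blast
qed

text \<open>The domination of \<open>g\<close> starts only at \<open>x / 8\<close>, whereas
  \<open>x - y\<close> is arbitrary. The truncation repairs this: for infinite \<open>T\<close> the
  set starts at \<open>max (x - y) (x / 4)\<close>; for finite \<open>T\<close> it is empty or
  \<open>x - y > x / 4 - \<tau> \<ge> x / 8\<close>.\<close>

lemma truncated_step_dominated:
  "\<exists>C\<ge>1. \<exists>D>0. \<forall>\<^sub>F x in at_top. \<forall>y.
    measure F (shift_Delta (x - y) T \<inter> {x / 4<..}) \<le> C * g x * exp (D * lam x * max y 0)"
proof -
  obtain C D where CD: "C \<ge> 1" "D > 0"
      and dom: "\<forall>\<^sub>F x in at_top. \<forall>z\<ge>x / 8. g z \<le> C * g x * exp (D * max (x - z) 0 * lam x)"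
    using g_dominated by auto
  \<comment> \<open>For infinite \<open>T\<close> the number \<tau> is a dummy, so that one
    threshold on \<open>x\<close> serves both cases.\<close>
  obtain \<tau> where \<tau>: "T = \<infinity> \<or> T = ereal \<tau>" "\<tau> > 0"
    using T by (cases T) (auto intro: that[of 1])
  have "\<forall>\<^sub>F x::real in at_top. x \<ge> max (8 * \<tau>) (exp 1)"
    by (rule eventually_ge_at_top)
  with dom have "\<forall>\<^sub>F x in at_top. \<forall>y.
    measure F (shift_Delta (x - y) T \<inter> {x / 4<..}) \<le> C * g x * exp (D * lam x * max y 0)"
  proof eventually_elim
    case (elim x)
    have x: "x > 1"
      using elim exp_ge_add_one_self[of 1] by (simp only: max.bounded_iff) linarith
    have main: "measure F (shift_Delta (x - y) T \<inter> {x / 4<..}) \<le> C * g x * exp (D * lam x * max y 0)"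
      if z: "z \<ge> x / 8" "z \<ge> x - y" and sub: "shift_Delta (x - y) T \<inter> {x / 4<..} \<subseteq> shift_Delta z T" for y z
    proof -
      have "measure F (shift_Delta (x - y) T \<inter> {x / 4<..}) \<le> g z"
        unfolding g_F using sub by (intro F.finite_measure_mono) (simp_all add: shift_Delta_eq)
      also have "\<dots> \<le> C * g x * exp (D * max (x - z) 0 * lam x)"
        using elim z by blast
      also have "\<dots> \<le> C * g x * exp (D * max y 0 * lam x)"
        using CD z lam_pos[OF x] g_nonneg[of x]
        by (intro mult_left_mono) (auto intro!: mult_right_mono mult_left_mono)
      finally show ?thesis
        by (simp add: mult_ac)
    qed
    show ?case
    proof
      fix y
      consider "T = \<infinity>" | "T = ereal \<tau>" "x - y + \<tau> \<le> x / 4" | "T = ereal \<tau>" "x - y + \<tau> > x / 4"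
        using \<tau> by fastforce
      then show "measure F (shift_Delta (x - y) T \<inter> {x / 4<..}) \<le> C * g x * exp (D * lam x * max y 0)"
      proof cases
        case 1
        then show ?thesis
          using x by (intro main[of "max (x - y) (x / 4)"]) (linarith, simp, auto simp: shift_Delta_eq)
      next
        case 2
        then have "shift_Delta (x - y) T \<inter> {x / 4<..} = {}"
          by (auto simp: shift_Delta_eq)
        then show ?thesis
          using CD g_nonneg[of x] by simp
      next
        case 3
        then show ?thesis
          using elim by (intro main[of "x - y"]) auto
      qed
    qed
  qed
  then show ?thesis
    using CD by blast
qed

text \<open>The other steps typically sum to order \<open>sqrt n\<close>. Within
  \<open>K * sqrt n\<close> insensitivity gives \<open>g x\<close> up to \<open>e / 2\<close>.
  Outside, Chebyshev gives probability at most \<open>1 / K^2\<close>, while the integrand may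
  exceed \<open>g x\<close> exponentially; the AM-GM bound trades one against the other at cost of
  order \<open>1 / K\<close>.\<close>

lemma prob_one_big_asymp:
  assumes e: "0 < e" "e < 1"
  shows "\<exists>\<eta>>0. \<forall>\<^sub>F x in at_top. \<forall>n i J. finite J \<and> i \<notin> J \<and> card J \<le> n \<and> n \<ge> 1 \<and> real n * (lam x)\<^sup>2 \<le> \<eta> \<longrightarrow>
    \<bar>prob (one_big (x / 4) x T i J) - g x\<bar> \<le> e * g x"
proof -
  obtain C D where CD: "C \<ge> 1" "D > 0" and dom: "\<forall>\<^sub>F x in at_top. \<forall>y.
    measure F (shift_Delta (x - y) T \<inter> {x / 4<..}) \<le> C * g x * exp (D * lam x * max y 0)"
    using truncated_step_dominated by auto
  obtain \<eta>1 where \<eta>1: "\<eta>1 > 0"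
      and near: "\<forall>\<^sub>F x in at_top. \<forall>y. \<bar>y\<bar> * lam x \<le> \<eta>1 \<longrightarrow> \<bar>g (x - y) - g x\<bar> \<le> e / 2 * g x"
    using g_insensitive[of "e / 2"] e by auto
  obtain \<eta>2 where \<eta>2: "\<eta>2 > 0"
      and bulk: "\<forall>\<^sub>F x in at_top. \<forall>n. real n * (lam x)\<^sup>2 \<le> \<eta>2 \<longrightarrow> mgf_upto (2 * D * lam x) (x / 4) ^ n \<le> 2"
    using mgf_bulk_bounded[of "2 * D"] CD by auto
  \<comment> \<open>The far part costs \<open>C / (2 K) + C / K + C / (2 K) = 2 C / K\<close>, from
    the constant, the moment generating function and Chebyshev; this is to be
    \<open>e / 2\<close>.\<close>
  define K where "K = 4 * C / e"
  have K: "K \<ge> 1" "2 * C / K = e / 2" "1 / K \<le> e / 4"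
    using CD e by (auto simp: K_def field_simps)
  \<comment> \<open>Ensures \<open>a * lam x \<le> min \<eta>1 (1 / 2)\<close> for
    \<open>a = K * sqrt n\<close>. The 1/2 gives \<open>a \<le> x / 2\<close>, so that on the near
    part truncation at \<open>x / 4\<close> removes nothing.\<close>
  define \<eta>3 where "\<eta>3 = min \<eta>1 (1 / 2) / K"
  have \<eta>3: "\<eta>3 > 0" "K * \<eta>3 = min \<eta>1 (1 / 2)"
    using \<eta>1 K by (auto simp: \<eta>3_def)
  define \<eta> where "\<eta> = min (min \<eta>2 (\<eta>3\<^sup>2)) 1"
  have \<eta>: "\<eta> > 0" "\<eta> \<le> \<eta>2" "\<eta> \<le> \<eta>3\<^sup>2" "\<eta> \<le> 1"
    using \<eta>2 \<eta>3 by (auto simp: \<eta>_def)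
  have "\<forall>\<^sub>F x in at_top. exp (- (3 / 4) * Q x) \<le> (e / 4) / x ^ 2"
    using exp_Q_le[of "3 / 4" "e / 4" 2] e by simp
  moreover have "\<forall>\<^sub>F x::real in at_top. x \<ge> exp 1"
    by (rule eventually_ge_at_top)
  ultimately have "\<forall>\<^sub>F x in at_top. \<forall>n i J. finite J \<and> i \<notin> J \<and> card J \<le> n \<and> n \<ge> 1 \<and> real n * (lam x)\<^sup>2 \<le> \<eta> \<longrightarrow>
    \<bar>prob (one_big (x / 4) x T i J) - g x\<bar> \<le> e * g x"
    using dom near bulk Ftail_quarter
  proof eventually_elim
    case (elim x)
    have x: "x > 1"
      using elim(2) exp_ge_add_one_self[of 1] by linarith
    note lam = lam_pos[OF x]
    show ?case
    proof (intro allI impI)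
      fix n i :: nat and J :: "nat set" assume nJ: "finite J \<and> i \<notin> J \<and> card J \<le> n \<and> n \<ge> 1 \<and> real n * (lam x)\<^sup>2 \<le> \<eta>"
      then have J: "finite J" "i \<notin> J" "card J \<le> n" and n: "n \<ge> 1" "real n * (lam x)\<^sup>2 \<le> \<eta>"
        by auto
      define a where "a = K * sqrt (real n)"
      have a: "a > 0"
        using K n by (simp add: a_def)
      have "(sqrt (real n) * lam x)\<^sup>2 \<le> \<eta>3\<^sup>2"
        using n \<eta>(3) by (simp add: power_mult_distrib)
      then have "sqrt (real n) * lam x \<le> \<eta>3"
        using \<eta>3(1) by (rule power2_le_imp_le[OF _ less_imp_le])
      then have "a * lam x \<le> K * \<eta>3"
        using K mult_left_mono[of "sqrt (real n) * lam x" \<eta>3 K] by (simp add: a_def)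
      then have a_lam: "a * lam x \<le> \<eta>1" "a * lam x \<le> 1 / 2"
        using \<eta>3(2) by auto
      have lam_x: "1 / x \<le> lam x"
        using lam_ge elim(2) by simp
      have "a * (1 / x) \<le> 1 / 2"
        using mult_left_mono[OF lam_x, of a] a a_lam by linarith
      then have a_x: "a \<le> x / 2"
        using x by (simp add: field_simps)
      have "real n * (1 / x)\<^sup>2 \<le> real n * (lam x)\<^sup>2"
        using lam_x x by (intro mult_left_mono power_mono) auto
      also have "\<dots> \<le> 1"
        using n \<eta>(4) by linarith
      finally have n_x: "real n \<le> x\<^sup>2"
        using x by (simp add: power_one_over field_simps)
      have far: "prob {\<omega> \<in> space M. \<bar>S J \<omega>\<bar> > a} \<le> 1 / K\<^sup>2"
      proof -
        have "prob {\<omega> \<in> space M. \<bar>S J \<omega>\<bar> > a} \<le> card J / a\<^sup>2"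
          using J a by (intro S_Chebyshev)
        also have "\<dots> \<le> real n / a\<^sup>2"
          using J by (intro divide_right_mono) auto
        also have "\<dots> = 1 / K\<^sup>2"
          using n by (simp add: a_def power_mult_distrib)
        finally show ?thesis .
      qed
      define m where "m y = measure F (shift_Delta (x - y) T \<inter> {x / 4<..})" for y
      define s where "s = 2 * D * lam x"
      have s: "s \<ge> 0"
        using CD lam by (simp add: s_def)
      have m_near: "\<bar>m y - g x\<bar> \<le> e / 2 * g x" if y: "\<bar>y\<bar> \<le> a" for y
      proof -
        have "x / 4 \<le> x - y"
          using y a_x x by auto
        then have "shift_Delta (x - y) T \<inter> {x / 4<..} = shift_Delta (x - y) T"
          by (auto simp: shift_Delta_eq)
        then have "m y = g (x - y)"
          by (simp add: m_def g_F)
        moreover have "\<bar>y\<bar> * lam x \<le> a * lam x"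
          using y lam by (intro mult_right_mono) auto
        ultimately show ?thesis
          using elim(4) a_lam by auto
      qed
      define far_ind where "far_ind = indicat_real {y. \<bar>y\<bar> > a}"
      have m_upper: "m y \<le> g x * ((1 + e / 2) + C / (2 * K) * (1 + exp (s * y)) + C * K / 2 * far_ind y)" for y
      proof (cases "\<bar>y\<bar> \<le> a")
        case True
        have "g x * (1 + e / 2) = g x + e / 2 * g x"
          by (simp add: algebra_simps)
        then have "m y \<le> g x * (1 + e / 2)"
          using m_near[OF True] by linarith
        also have "\<dots> \<le> g x * ((1 + e / 2) + C / (2 * K) * (1 + exp (s * y)) + C * K / 2 * far_ind y)"
        proof -
          have "0 \<le> C / (2 * K) * (1 + exp (s * y))" "0 \<le> C * K / 2 * far_ind y"
            using CD K by (auto simp: far_ind_def add_nonneg_nonneg)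
          then show ?thesis
            using g_nonneg[of x] by (intro mult_left_mono) auto
        qed
        finally show ?thesis .
      next
        case False
        have "m y \<le> C * g x * exp (D * lam x * max y 0)"
          using elim(3) by (simp add: m_def)
        also have "\<dots> = C * g x * (exp (D * lam x * max y 0) * far_ind y)"
          using False by (simp add: far_ind_def)
        also have "\<dots> \<le> C * g x * ((1 + exp (2 * (D * lam x) * y)) / (2 * K) + K / 2 * far_ind y)"
          unfolding far_ind_def using CD K g_nonneg[of x] by (intro mult_left_mono exp_ratio_le) auto
        also have "\<dots> = g x * (C / (2 * K) * (1 + exp (s * y)) + C * K / 2 * far_ind y)"
          by (simp add: s_def algebra_simps add_divide_distrib)
        also have "\<dots> \<le> g x * ((1 + e / 2) + C / (2 * K) * (1 + exp (s * y)) + C * K / 2 * far_ind y)"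
          using e g_nonneg[of x] by (intro mult_left_mono) auto
        finally show ?thesis .
      qed
      \<comment> \<open>The exponential keeps the indicator of \<open>small\<close>, without which
        its expectation might be infinite; the other terms can drop it because they are
        nonnegative.\<close>
      define U where "U \<omega> = g x * (((1 + e / 2) + C / (2 * K)) +
        C / (2 * K) * (exp (s * S J \<omega>) * indicator (small (x / 4) J) \<omega>) +
        C * K / 2 * indicator {\<omega> \<in> space M. \<bar>S J \<omega>\<bar> > a} \<omega>)" for \<omega>
      have far_ev [measurable]: "{\<omega> \<in> space M. \<bar>S J \<omega>\<bar> > a} \<in> events"
        by measurable
      have ints: "integrable M (\<lambda>\<omega>. C / (2 * K) * (exp (s * S J \<omega>) * indicator (small (x / 4) J) \<omega>))"
          "integrable M (\<lambda>\<omega>. C * K / 2 * indicat_real {\<omega> \<in> space M. \<bar>S J \<omega>\<bar> > a} \<omega>)"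
        using exp_S_small(1)[OF J(1) s]
        by (intro integrable_mult_right integrable_real_indicator; simp add: emeasure_eq_measure)+
      have U_int: "integrable M U"
        unfolding U_def
        by (intro integrable_mult_right
            Bochner_Integration.integrable_add[OF Bochner_Integration.integrable_add[OF integrable_const ints(1)] ints(2)])
      have "expectation U = g x * (((1 + e / 2) + C / (2 * K)) + C / (2 * K) * mgf_upto s (x / 4) ^ card J +
          C * K / 2 * prob {\<omega> \<in> space M. \<bar>S J \<omega>\<bar> > a})"
      proof -
        have "expectation U = g x * (expectation (\<lambda>\<omega>. (1 + e / 2) + C / (2 * K)) +
           expectation (\<lambda>\<omega>. C / (2 * K) * (exp (s * S J \<omega>) * indicator (small (x / 4) J) \<omega>)) +
           expectation (\<lambda>\<omega>. C * K / 2 * indicat_real {\<omega> \<in> space M. \<bar>S J \<omega>\<bar> > a} \<omega>))"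
          unfolding U_def
          by (simp only: integral_mult_right_zero Bochner_Integration.integral_add
              Bochner_Integration.integrable_add ints integrable_const)
        also have "expectation (\<lambda>\<omega>. C / (2 * K) * (exp (s * S J \<omega>) * indicator (small (x / 4) J) \<omega>)) =
            C / (2 * K) * mgf_upto s (x / 4) ^ card J"
          by (simp only: integral_mult_right_zero exp_S_small(2)[OF J(1) s])
        also have "expectation (\<lambda>\<omega>. C * K / 2 * indicat_real {\<omega> \<in> space M. \<bar>S J \<omega>\<bar> > a} \<omega>) =
            C * K / 2 * prob {\<omega> \<in> space M. \<bar>S J \<omega>\<bar> > a}"
        proof -
          have "expectation (indicat_real A) = prob A" if "A \<in> events" for A
            using sets.sets_into_space[OF that] by (simp add: Int_absorb2)
          from this[OF far_ev] show ?thesis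
            by (simp only: integral_mult_right_zero)
        qed
        finally show ?thesis
          by (simp add: prob_space)
      qed
      also have "\<dots> \<le> g x * (((1 + e / 2) + C / (2 * K)) + C / (2 * K) * 2 + C * K / 2 * (1 / K\<^sup>2))"
      proof -
        have "real (card J) * (lam x)\<^sup>2 \<le> real n * (lam x)\<^sup>2"
          using J by (intro mult_right_mono) auto
        then have "mgf_upto s (x / 4) ^ card J \<le> 2"
          using elim(5) n \<eta>(2) unfolding s_def by (meson order_trans)
        then show ?thesis
          using far CD K g_nonneg[of x] by (intro mult_left_mono add_mono order_refl) auto
      qed
      also have "\<dots> = g x * (1 + e / 2 + 2 * C / K)"
        using K by (simp add: field_simps power2_eq_square)
      also have "\<dots> = (1 + e) * g x"
        unfolding K(2) by (simp add: algebra_simps)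
      finally have U_le: "expectation U \<le> (1 + e) * g x" .
      define H where "H \<omega> = m (S J \<omega>) * indicator (small (x / 4) J) \<omega>" for \<omega>
      have H_meas: "H \<in> borel_measurable M" and H_prob: "prob (one_big (x / 4) x T i J) = expectation H"
        using prob_one_big[OF J(1,2), where h="x / 4" and x=x and T=T] unfolding H_def m_def by auto
      have "\<bar>H \<omega>\<bar> \<le> 1" for \<omega>
        by (auto simp: H_def m_def indicator_def)
      then have H_int: "integrable M H"
        using H_meas by (intro integrable_const_bound[of _ 1]) auto
      have "expectation H \<le> expectation U"
      proof (rule integral_mono[OF H_int U_int])
        fix \<omega> assume w: "\<omega> \<in> space M"
        show "H \<omega> \<le> U \<omega>"
        proof (cases "\<omega> \<in> small (x / 4) J")
          case True
          then show ?thesis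
            using m_upper[of "S J \<omega>"] w by (simp add: H_def U_def far_ind_def indicator_def algebra_simps)
        next
          case False
          then show ?thesis
            using CD K e g_nonneg[of x]
            by (auto simp: H_def U_def intro!: mult_nonneg_nonneg add_nonneg_nonneg)
        qed
      qed
      then have upper: "prob (one_big (x / 4) x T i J) \<le> (1 + e) * g x"
        using U_le H_prob by simp
      \<comment> \<open>For the lower bound only this event is kept: the integrand is at least
        \<open>(1 - e / 2) * g x\<close> on it and its probability is at least
        \<open>1 - e / 2\<close>.\<close>
      define N where "N = small (x / 4) J - {\<omega> \<in> space M. \<bar>S J \<omega>\<bar> > a}"
      have N_ev [measurable]: "N \<in> events"
        unfolding N_def using J by auto
      have N_sub: "N \<subseteq> space M"
        using sets.sets_into_space[OF N_ev] .
      have "prob (space M - N) \<le> prob ((space M - small (x / 4) J) \<union> {\<omega> \<in> space M. \<bar>S J \<omega>\<bar> > a})"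
        using J by (intro finite_measure_mono) (auto simp: N_def)
      also have "\<dots> \<le> prob (space M - small (x / 4) J) + prob {\<omega> \<in> space M. \<bar>S J \<omega>\<bar> > a}"
        using J by (intro measure_Un_le) auto
      also have "\<dots> \<le> real n * Ftail (x / 4) + 1 / K\<^sup>2"
      proof (rule add_mono[OF _ far])
        have "prob (space M - small (x / 4) J) \<le> card J * Ftail (x / 4)"
          by (rule prob_not_small[OF J(1)])
        also have "\<dots> \<le> real n * Ftail (x / 4)"
          using J Ftail_nonneg by (intro mult_right_mono) auto
        finally show "prob (space M - small (x / 4) J) \<le> real n * Ftail (x / 4)" .
      qed
      also have "real n * Ftail (x / 4) \<le> x\<^sup>2 * ((e / 4) / x\<^sup>2)"
        using n_x elim Ftail_nonneg by (intro mult_mono) auto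
      also have "\<dots> = e / 4"
        using x by simp
      also have "1 / K\<^sup>2 \<le> 1 / K"
        using K by (simp add: power2_eq_square field_simps)
      finally have N_prob: "prob N \<ge> 1 - e / 2"
        using K(3) prob_compl[OF N_ev] by simp
      have "(1 - e) * g x \<le> ((1 - e / 2) * (1 - e / 2)) * g x"
        using g_nonneg[of x] by (intro mult_right_mono) (auto simp: algebra_simps)
      also have "\<dots> = (1 - e / 2) * g x * (1 - e / 2)"
        by simp
      also have "\<dots> \<le> (1 - e / 2) * g x * prob N"
        using N_prob e g_nonneg[of x] by (intro mult_left_mono) auto
      also have "\<dots> = expectation (\<lambda>\<omega>. (1 - e / 2) * g x * indicator N \<omega>)"
        using N_sub by (simp add: Int_absorb2)
      also have "\<dots> \<le> expectation H"
      proof (rule integral_mono[OF _ H_int])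
        show "integrable M (\<lambda>\<omega>. (1 - e / 2) * g x * indicator N \<omega>)"
          by (intro integrable_mult_right integrable_real_indicator) (auto simp: emeasure_eq_measure)
        fix \<omega> assume w: "\<omega> \<in> space M"
        show "(1 - e / 2) * g x * indicator N \<omega> \<le> H \<omega>"
        proof (cases "\<omega> \<in> N")
          case True
          then have "\<omega> \<in> small (x / 4) J" "\<bar>S J \<omega>\<bar> \<le> a"
            using w by (auto simp: N_def)
          moreover have "(1 - e / 2) * g x = g x - e / 2 * g x"
            by (simp add: algebra_simps)
          ultimately have "(1 - e / 2) * g x \<le> m (S J \<omega>)"
            using m_near[of "S J \<omega>"] by linarith
          with True \<open>\<omega> \<in> small (x / 4) J\<close> show ?thesis
            by (simp add: H_def)
        qed (simp add: H_def m_def)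
      qed
      finally have "g x - e * g x \<le> prob (one_big (x / 4) x T i J)"
        by (simp add: H_prob left_diff_distrib)
      moreover have "prob (one_big (x / 4) x T i J) \<le> g x + e * g x"
        using upper by (simp add: distrib_right)
      ultimately show "\<bar>prob (one_big (x / 4) x T i J) - g x\<bar> \<le> e * g x"
        by linarith
    qed
  qed
  then show ?thesis
    using \<eta>(1) by blast
qed

text \<open>The budget \<open>e\<close> is split into three: no large step, the deviation of the
  single-jump sum, and two or more large steps each cost at most
  \<open>d * (n * g x)\<close>.\<close>

lemma big_jump_asymp:
  assumes \<rho>: "\<rho> < 1 / 2" and e: "0 < e" "e < 1"
  shows "\<exists>\<eta>>0. \<forall>\<^sub>F x in at_top. \<forall>n\<ge>1. real n * (lam x)\<^sup>2 \<le> \<eta> \<and> real n * Q x \<le> \<rho> * x\<^sup>2 \<longrightarrow>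
    \<bar>prob {\<omega> \<in> space M. S {1..n} \<omega> \<in> shift_Delta x T} / (real n * g x) - 1\<bar> \<le> e"
proof -
  define d where "d = e / 3"
  have d: "0 < d" "d < 1"
    using e by (auto simp: d_def)
  obtain \<eta>1 where \<eta>1: "\<eta>1 > 0" and one: "\<forall>\<^sub>F x in at_top. \<forall>n i J. finite J \<and> i \<notin> J \<and> card J \<le> n \<and> n \<ge> 1 \<and> real n * (lam x)\<^sup>2 \<le> \<eta>1 \<longrightarrow>
    \<bar>prob (one_big (x / 4) x T i J) - g x\<bar> \<le> d * g x"
    using prob_one_big_asymp[OF d] by auto
  define \<eta> where "\<eta> = min \<eta>1 1"
  have \<eta>: "\<eta> > 0" "\<eta> \<le> \<eta>1" "\<eta> \<le> 1"
    using \<eta>1 by (auto simp: \<eta>_def)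
  have "\<forall>\<^sub>F x in at_top. exp (- (1 / 4) * Q x) \<le> d / x ^ 2"
    using exp_Q_le[of "1 / 4" d 2] d by simp
  moreover have "\<forall>\<^sub>F x in at_top. exp (- (1 + 1 / 4) * Q x) \<le> g x"
    using g_bounds[of "1 / 4"] by (auto elim: eventually_mono)
  moreover have "\<forall>\<^sub>F x::real in at_top. x \<ge> exp 1"
    by (rule eventually_ge_at_top)
  ultimately have "\<forall>\<^sub>F x in at_top. \<forall>n\<ge>1. real n * (lam x)\<^sup>2 \<le> \<eta> \<and> real n * Q x \<le> \<rho> * x\<^sup>2 \<longrightarrow>
    \<bar>prob {\<omega> \<in> space M. S {1..n} \<omega> \<in> shift_Delta x T} / (real n * g x) - 1\<bar> \<le> e"
    using one no_big_jump[OF \<rho> d(1)] Ftail_quarter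
  proof eventually_elim
    case (elim x)
    have x: "x > 1"
      using elim(3) exp_ge_add_one_self[of 1] by linarith
    have gx: "g x > 0"
      using elim(2) exp_gt_zero less_le_trans by blast
    show ?case
    proof (intro allI impI)
      fix n :: nat assume n: "n \<ge> 1" and nx: "real n * (lam x)\<^sup>2 \<le> \<eta> \<and> real n * Q x \<le> \<rho> * x\<^sup>2"
      define P where "P = prob {\<omega> \<in> space M. S {1..n} \<omega> \<in> shift_Delta x T}"
      define B where "B = (\<Sum>i\<in>{1..n}. prob (one_big (x / 4) x T i ({1..n} - {i})))"
      have one': "\<bar>prob (one_big (x / 4) x T i ({1..n} - {i})) - g x\<bar> \<le> d * g x" for i
        using elim(4)[rule_format, of "{1..n} - {i}" i n] n nx \<eta> by (auto simp: card_Diff_singleton_if)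
      have "\<bar>B - real n * g x\<bar> = \<bar>\<Sum>i\<in>{1..n}. (prob (one_big (x / 4) x T i ({1..n} - {i})) - g x)\<bar>"
        by (simp add: B_def sum_subtractf)
      also have "\<dots> \<le> (\<Sum>i\<in>{1..n}. d * g x)"
        using one' by (intro order_trans[OF sum_abs] sum_mono)
      finally have B: "\<bar>B - real n * g x\<bar> \<le> d * (real n * g x)"
        by (simp add: algebra_simps)
      have "real n * (1 / x)\<^sup>2 \<le> real n * (lam x)\<^sup>2"
        using lam_ge[OF elim(3)] x by (intro mult_left_mono power_mono) auto
      also have "\<dots> \<le> 1"
        using nx \<eta>(3) by linarith
      finally have n_x: "real n \<le> x\<^sup>2"
        using x by (simp add: power_one_over field_simps)
      \<comment> \<open>The exponent 3/2 splits as \<open>1 / 4 + (1 + 1 / 4)\<close>: the first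
        part absorbs one factor \<open>n \<le> x^2\<close>, the second is bounded by
        \<open>g x\<close>.\<close>
      have "(real n * Ftail (x / 4))\<^sup>2 \<le> (real n * exp (- (3 / 4) * Q x))\<^sup>2"
        using elim(6) Ftail_nonneg by (intro power_mono mult_left_mono) auto
      also have "\<dots> = real n * (real n * exp (- (1 / 4) * Q x)) * exp (- (1 + 1 / 4) * Q x)"
        by (simp add: power2_eq_square flip: exp_add)
      also have "\<dots> \<le> real n * (x\<^sup>2 * (d / x\<^sup>2)) * g x"
        using n_x elim(1,2) d by (intro mult_mono) (auto simp: divide_nonneg_nonneg)
      also have "\<dots> = d * (real n * g x)"
        using x by simp
      finally have two: "(real n * Ftail (x / 4))\<^sup>2 \<le> d * (real n * g x)" .
      have "prob {\<omega> \<in> small (x / 4) {1..n}. S {1..n} \<omega> > x} \<le> d * g x"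
        using elim(5) nx by blast
      also have "\<dots> \<le> d * (real n * g x)"
        using n gx d by simp
      finally have none: "prob {\<omega> \<in> small (x / 4) {1..n}. S {1..n} \<omega> > x} \<le> d * (real n * g x)" .
      have "P \<le> prob {\<omega> \<in> small (x / 4) {1..n}. S {1..n} \<omega> > x} + B + (real n * Ftail (x / 4))\<^sup>2" "B \<le> P"
        unfolding P_def B_def by (rule big_jump_decomposition)+
      then have "\<bar>P - real n * g x\<bar> \<le> e * (real n * g x)"
      proof -
        define t where "t = e * (real n * g x)"
        have "d * (real n * g x) = t / 3"
          by (simp add: d_def t_def)
        with none two B \<open>P \<le> _\<close> \<open>B \<le> P\<close> show ?thesis
          unfolding t_def[symmetric] by linarith
      qed
      moreover have "P / (real n * g x) - 1 = (P - real n * g x) / (real n * g x)"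
        using n gx by (simp add: diff_divide_distrib)
      ultimately show "\<bar>prob {\<omega> \<in> space M. S {1..n} \<omega> \<in> shift_Delta x T} / (real n * g x) - 1\<bar> \<le> e"
        using n gx unfolding P_def by (simp add: abs_divide divide_le_eq)
    qed
  qed
  then show ?thesis
    using \<eta>(1) by blast
qed

end

section \<open>The boundary sequences\<close>

text \<open>The logarithm \<open>b * ln (ln u) - ln u\<close> decreases once
  \<open>ln u \<ge> b\<close>; this follows from \<open>ln w \<le> w - 1\<close> at
  \<open>w = ln v / ln u\<close>, without differentiation.\<close>

lemma ln_powr_over_antimono:
  fixes b u v :: real
  assumes "b > 0" "exp b \<le> u" "u \<le> v"
  shows "ln v powr b / v \<le> ln u powr b / u"
proof -
  have "u > 1"
    using assms exp_gt_one[of b] by linarith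
  moreover have "b \<le> ln u"
    using assms by (subst ln_ge_iff) (use \<open>u > 1\<close> in auto)
  ultimately have u: "u > 1" "ln u \<ge> b" "v > 1" "ln v \<ge> ln u"
    using assms by auto
  have "ln (ln v) - ln (ln u) \<le> ln v / ln u - 1"
    using u assms ln_le_minus_one[of "ln v / ln u"] by (simp add: ln_div)
  also have "\<dots> = (ln v - ln u) / ln u"
    using u assms by (simp add: diff_divide_distrib)
  also have "\<dots> \<le> (ln v - ln u) / b"
    using u assms by (intro divide_left_mono) auto
  finally have "b * ln (ln v) - ln v \<le> b * ln (ln u) - ln u"
    using assms by (simp add: field_simps)
  then have "exp (b * ln (ln v) - ln v) \<le> exp (b * ln (ln u) - ln u)"
    by simp
  then show ?thesis
    using u by (simp add: exp_diff powr_def)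
qed

context heavy_walk
begin

lemma lam_antimono: "exp (\<beta> - 1) \<le> u \<Longrightarrow> u \<le> v \<Longrightarrow> lam v \<le> lam u"
  unfolding lam_def using \<beta> by (intro ln_powr_over_antimono) auto

lemma Q_ratio_antimono:
  assumes "exp \<beta> \<le> u" "u \<le> v"
  shows "Q v / v\<^sup>2 \<le> Q u / u\<^sup>2"
proof -
  have u: "u > 0"
    using assms by (meson exp_gt_zero less_le_trans)
  have "c * (ln v powr \<beta> / v) / v \<le> c * (ln u powr \<beta> / u) / u"
    using assms u c \<beta> by (intro frac_le mult_left_mono ln_powr_over_antimono) auto
  then show ?thesis
    by (simp add: Q_def power2_eq_square)
qed

text \<open>The hypotheses are quantified differently because \<rho> is fixed in advance, while the
  admissible \<eta> shrinks with the accuracy \<open>e\<close>.\<close>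

lemma local_large_deviations_from:
  assumes xs: "filterlim xs at_top sequentially"
    and lam_xs: "\<And>\<eta>. \<eta> > 0 \<Longrightarrow> \<forall>\<^sub>F n in sequentially. real n * (lam (xs n))\<^sup>2 \<le> \<eta>"
    and \<rho>: "\<rho> < 1 / 2" and Q_xs: "\<forall>\<^sub>F n in sequentially. real n * Q (xs n) \<le> \<rho> * (xs n)\<^sup>2"
  shows "local_large_deviations M \<xi> F T xs"
proof -
  define r where "r n x = prob {\<omega> \<in> space M. S {1..n} \<omega> \<in> shift_Delta x T} / (real n * g x) - 1" for n x
  have small: "\<forall>\<^sub>F n in sequentially. (SUP x\<in>{xs n..}. ereal \<bar>r n x\<bar>) \<le> ereal e" if e: "0 < e" "e < 1" for e
  proof -
    obtain \<eta> where \<eta>: "\<eta> > 0" and "\<forall>\<^sub>F x in at_top. \<forall>n\<ge>1. real n * (lam x)\<^sup>2 \<le> \<eta> \<and> real n * Q x \<le> \<rho> * x\<^sup>2 \<longrightarrow> \<bar>r n x\<bar> \<le> e"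
      using big_jump_asymp[OF \<rho> e] unfolding r_def by auto
    then obtain X where X: "\<And>x n. x \<ge> X \<Longrightarrow> n \<ge> 1 \<Longrightarrow> real n * (lam x)\<^sup>2 \<le> \<eta> \<Longrightarrow> real n * Q x \<le> \<rho> * x\<^sup>2 \<Longrightarrow> \<bar>r n x\<bar> \<le> e"
      unfolding eventually_at_top_linorder by blast
    have "\<forall>\<^sub>F n in sequentially. max X (exp \<beta>) \<le> xs n"
      using xs by (simp only: filterlim_at_top)
    with lam_xs[OF \<eta>] Q_xs eventually_ge_at_top[of 1] show ?thesis
    proof eventually_elim
      case (elim n)
      show ?case
      proof (rule SUP_least)
        fix x assume "x \<in> {xs n..}"
        then have x: "xs n \<le> x" "x \<ge> X" "exp \<beta> \<le> xs n" "exp \<beta> \<le> x"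
          using elim by auto
        have pos: "xs n > 0" "x > 1"
          using x exp_gt_zero[of \<beta>] exp_gt_one[of \<beta>] \<beta> by linarith+
        have "exp (\<beta> - 1) \<le> xs n"
          using x(3) by (rule order_trans[rotated]) simp
        then have "lam x \<le> lam (xs n)"
          using x by (intro lam_antimono)
        then have "real n * (lam x)\<^sup>2 \<le> real n * (lam (xs n))\<^sup>2"
          using lam_pos[OF pos(2)] by (intro mult_left_mono power_mono) auto
        then have "real n * (lam x)\<^sup>2 \<le> \<eta>"
          using elim(1) by linarith
        moreover have "real n * Q x \<le> \<rho> * x\<^sup>2"
        proof -
          have "real n * (Q x / x\<^sup>2) \<le> real n * (Q (xs n) / (xs n)\<^sup>2)"
            using x by (intro mult_left_mono Q_ratio_antimono) auto
          also have "\<dots> \<le> \<rho>"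
            using elim pos by (simp add: divide_le_eq)
          finally show ?thesis
            using pos by (simp add: divide_le_eq)
        qed
        ultimately have "\<bar>r n x\<bar> \<le> e"
          using x(2) elim(3) by (intro X)
        then show "ereal \<bar>r n x\<bar> \<le> ereal e"
          by simp
      qed
    qed
  qed
  have "(\<lambda>n. SUP x\<in>{xs n..}. ereal \<bar>r n x\<bar>) \<longlonglongrightarrow> 0"
  proof (rule order_tendstoI)
    fix a :: ereal assume "a < 0"
    moreover have "0 \<le> (SUP x\<in>{xs n..}. ereal \<bar>r n x\<bar>)" for n
      by (rule SUP_upper2[of "xs n"]) auto
    ultimately show "\<forall>\<^sub>F n in sequentially. a < (SUP x\<in>{xs n..}. ereal \<bar>r n x\<bar>)"
      by (auto intro: always_eventually less_le_trans)
  next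
    fix a :: ereal assume "0 < a"
    then have "0 < min a 1"
      by simp
    then obtain e where "0 < ereal e" "ereal e < min a 1"
      using ereal_dense2 by blast
    then have e: "0 < e" "e < 1" "ereal e < a"
      by auto
    from small[OF e(1,2)] show "\<forall>\<^sub>F n in sequentially. (SUP x\<in>{xs n..}. ereal \<bar>r n x\<bar>) < a"
      by eventually_elim (use e(3) in auto)
  qed
  moreover have "partial_sum \<xi> n = S {1..n}" for n
    by (auto simp: partial_sum_def S_def)
  ultimately show ?thesis
    by (simp add: local_large_deviations_def equiv_uniformly_from_def r_def g_F)
qed

text \<open>Here \<open>n Q(x\<^sub>n) / x\<^sub>n\<^sup>2\<close> tends to \<open>c 2\<^sup>-\<^sup>\<beta> / t\<close>, and the hypothesis on \<open>t\<close> says that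
  this limit is below \<open>1 / 2\<close>.\<close>

lemma local_large_deviations_sqrt:
  assumes "\<beta> < 2" and t: "t > 2 powr (1 - \<beta>) * c"
  shows "local_large_deviations M \<xi> F T (\<lambda>n. sqrt (t * real n * ln (real n) powr \<beta>))"
proof -
  define xs where "xs n = sqrt (t * real n * ln (real n) powr \<beta>)" for n
  have t0: "t > 0"
    using t c by (smt (verit) mult_pos_pos powr_gt_zero)
  have xs_top: "filterlim xs at_top sequentially"
    unfolding xs_def using t0 \<beta> by real_asymp
  \<comment> \<open>The sequence is of order \<open>ln n powr (\<beta> - 2)\<close>, so it vanishes
    because \<beta> < 2.\<close>
  have lim0: "(\<lambda>n. real n * (lam (xs n))\<^sup>2) \<longlonglongrightarrow> 0"
    unfolding xs_def lam_def using t0 \<beta> assms(1) by real_asymp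
  have lam_xs: "\<forall>\<^sub>F n in sequentially. real n * (lam (xs n))\<^sup>2 \<le> \<eta>" if "\<eta> > 0" for \<eta>
    using order_tendstoD(2)[OF lim0 that] by (rule eventually_mono) simp
  have "(\<lambda>n. real n * Q (xs n) / (xs n)\<^sup>2) \<longlonglongrightarrow> c * (1 / 2) powr \<beta> * inverse ((t powr (1 / 2))\<^sup>2)"
    unfolding xs_def Q_def using t0 \<beta> c by real_asymp
  also have "c * (1 / 2) powr \<beta> * inverse ((t powr (1 / 2))\<^sup>2) = c * (1 / 2) powr \<beta> / t"
  proof -
    have "(t powr (1 / 2))\<^sup>2 = t"
      using t0 by (simp add: power2_eq_square flip: powr_add)
    then show ?thesis
      by (simp only: divide_inverse)
  qed
  finally have "(\<lambda>n. real n * Q (xs n) / (xs n)\<^sup>2) \<longlonglongrightarrow> c * (1 / 2) powr \<beta> / t" .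
  moreover have "c * (1 / 2) powr \<beta> / t < 1 / 2"
    using t t0 by (simp add: powr_diff powr_divide field_simps)
  then obtain \<rho> where "c * (1 / 2) powr \<beta> / t < \<rho>" "\<rho> < 1 / 2"
    using dense by blast
  ultimately have "\<forall>\<^sub>F n in sequentially. real n * Q (xs n) / (xs n)\<^sup>2 < \<rho>"
    by (intro order_tendstoD(2))
  moreover have "\<forall>\<^sub>F n in sequentially. xs n \<ge> 1"
    using xs_top by (simp add: filterlim_at_top)
  ultimately have "\<forall>\<^sub>F n in sequentially. real n * Q (xs n) \<le> \<rho> * (xs n)\<^sup>2"
    by eventually_elim (simp add: divide_less_eq split: if_splits)
  then show ?thesis
    using local_large_deviations_from[OF xs_top lam_xs \<open>\<rho> < 1 / 2\<close>] by (simp add: xs_def)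
qed

text \<open>The logarithm of an arbitrary \<open>x n\<close> cannot be compared with
  \<open>ln n\<close>. Monotonicity moves both conditions down to the explicit sequence
  \<open>y K\<close>, which is eventually below \<open>x\<close> for each \<open>K\<close>; there
  they hold with bounds of order \<open>1 / K^2\<close>.\<close>

lemma local_large_deviations_beyond:
  assumes "\<beta> \<ge> 2" and pos: "\<forall>\<^sub>F n in sequentially. 0 < x n"
    and ratio: "(\<lambda>n. sqrt (real n * ln (real n) powr (2 * \<beta> - 2)) / x n) \<longlonglongrightarrow> 0"
  shows "local_large_deviations M \<xi> F T x"
proof -
  define y where "y K n = K * sqrt (real n * ln (real n) powr (2 * \<beta> - 2))" for K :: real and n
  have y_le: "\<forall>\<^sub>F n in sequentially. y K n \<le> x n" if "K \<ge> 1" for K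
  proof -
    have "\<forall>\<^sub>F n in sequentially. sqrt (real n * ln (real n) powr (2 * \<beta> - 2)) / x n < 1 / K"
      using ratio by (rule order_tendstoD) (use that in simp)
    with pos show ?thesis
      by eventually_elim (use that in \<open>simp add: y_def field_simps\<close>)
  qed
  have y_top: "filterlim (y K) at_top sequentially" if "K \<ge> 1" for K
    unfolding y_def using that \<beta> by real_asymp
  \<comment> \<open>Gives \<open>ln (y K n) \<le> ln n\<close>; the lost factor 1/2 is irrelevant
    here since \<open>K\<close> is free.\<close>
  have y_small: "\<forall>\<^sub>F n in sequentially. y K n \<le> real n" if "K \<ge> 1" for K
  proof -
    have "(\<lambda>n. y K n / real n) \<longlonglongrightarrow> 0"
      unfolding y_def using that \<beta> by real_asymp
    then have "\<forall>\<^sub>F n in sequentially. y K n / real n < 1"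
      by (rule order_tendstoD) simp
    with eventually_gt_at_top[of 0] show ?thesis
      by eventually_elim (simp add: divide_less_eq)
  qed
  have main: "\<forall>\<^sub>F n in sequentially. real n * (lam (x n))\<^sup>2 \<le> 1 / K\<^sup>2 \<and> real n * Q (x n) \<le> c / K\<^sup>2 * (x n)\<^sup>2"
    if K: "K \<ge> 1" for K
  proof -
    have "\<forall>\<^sub>F n in sequentially. y K n \<ge> exp \<beta>"
      using y_top[OF K] by (simp add: filterlim_at_top)
    moreover have "filterlim (\<lambda>n. ln (real n)) at_top sequentially"
      by real_asymp
    then have "\<forall>\<^sub>F n in sequentially. ln (real n) \<ge> 1"
      by (simp add: filterlim_at_top)
    ultimately show ?thesis
      using y_le[OF K] y_small[OF K] eventually_ge_at_top[of 1]
    proof eventually_elim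
      case (elim n)
      have y1: "y K n > 1" "x n > 1"
        using elim exp_gt_one[of \<beta>] \<beta> by linarith+
      have ln_y: "ln (y K n) \<le> ln (real n)" "ln (y K n) \<ge> 0"
        using y1 elim by (auto intro!: ln_mono)
      define L where "L = ln (real n)"
      have L: "L \<ge> 1" "L > 0"
        using elim(2) unfolding L_def by linarith+
      have y_sq: "(y K n)\<^sup>2 = K\<^sup>2 * (real n * L powr (2 * \<beta> - 2))"
        by (simp add: y_def L_def power_mult_distrib)
      have "exp (\<beta> - 1) \<le> y K n"
        using elim(1) by (rule order_trans[rotated]) simp
      then have "real n * (lam (x n))\<^sup>2 \<le> real n * (lam (y K n))\<^sup>2"
        using lam_antimono[of "y K n" "x n"] elim lam_pos[OF y1(2)]
        by (intro mult_left_mono power_mono) auto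
      also have "\<dots> = real n * (ln (y K n) powr (\<beta> - 1))\<^sup>2 / (y K n)\<^sup>2"
        by (simp add: lam_def power_divide)
      also have "\<dots> \<le> real n * (L powr (\<beta> - 1))\<^sup>2 / (y K n)\<^sup>2"
        using ln_y \<beta> unfolding L_def
        by (intro divide_right_mono mult_left_mono power_mono powr_mono2) auto
      also have "(L powr (\<beta> - 1))\<^sup>2 = L powr (2 * \<beta> - 2)"
        using L by (simp add: power2_eq_square flip: powr_add)
      also have "real n * L powr (2 * \<beta> - 2) / (y K n)\<^sup>2 = 1 / K\<^sup>2"
        unfolding y_sq using L elim by simp
      finally have 1: "real n * (lam (x n))\<^sup>2 \<le> 1 / K\<^sup>2" .
      have "real n * (Q (x n) / (x n)\<^sup>2) \<le> real n * (Q (y K n) / (y K n)\<^sup>2)"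
        using elim by (intro mult_left_mono Q_ratio_antimono) auto
      also have "\<dots> \<le> real n * (c * L powr (2 * \<beta> - 2) / (y K n)\<^sup>2)"
      proof -
        have "ln (y K n) powr \<beta> \<le> L powr \<beta>"
          using ln_y \<beta> unfolding L_def by (intro powr_mono2) auto
        \<comment> \<open>Here \<beta> \<ge> 2 enters: the condition on \<open>Q\<close> is no
          stronger than the one on \<open>lam\<close>.\<close>
        also have "\<dots> \<le> L powr (2 * \<beta> - 2)"
          using L assms(1) by (intro powr_mono) auto
        finally show ?thesis
          using c unfolding Q_def by (intro mult_left_mono divide_right_mono) auto
      qed
      also have "\<dots> = c / K\<^sup>2"
        unfolding y_sq using L elim by simp
      finally have "real n * Q (x n) \<le> c / K\<^sup>2 * (x n)\<^sup>2"
        using y1 by (simp add: divide_le_eq)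
      with 1 show ?case
        by simp
    qed
  qed
  show ?thesis
  proof (rule local_large_deviations_from)
    show "filterlim x at_top sequentially"
      by (rule filterlim_at_top_mono[OF y_top[of 1] y_le[of 1]]) simp_all
    show "(1 / 4 :: real) < 1 / 2"
      by simp
    define K where "K = max 1 (4 * c)"
    have "c / K\<^sup>2 \<le> 1 / 4"
    proof -
      have "4 * c * 1 \<le> K * K"
        using c by (intro mult_mono) (auto simp: K_def)
      moreover have "K > 0"
        by (simp add: K_def)
      ultimately show ?thesis
        by (simp add: power2_eq_square divide_le_eq)
    qed
    then have K_le: "c / K\<^sup>2 * (x n)\<^sup>2 \<le> 1 / 4 * (x n)\<^sup>2" for n
      by (intro mult_right_mono) auto
    have "K \<ge> 1"
      by (simp add: K_def)
    from main[OF this] show "\<forall>\<^sub>F n in sequentially. real n * Q (x n) \<le> 1 / 4 * (x n)\<^sup>2"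
    proof eventually_elim
      case (elim n)
      then show ?case
        using K_le[of n] by linarith
    qed
  next
    fix \<eta> :: real assume \<eta>: "\<eta> > 0"
    define K where "K = max 1 (1 / \<eta>)"
    have K: "K \<ge> 1" "1 / \<eta> \<le> K"
      by (auto simp: K_def)
    have "1 / K\<^sup>2 \<le> 1 / K"
      using K by (simp add: power2_eq_square field_simps)
    also have "\<dots> \<le> \<eta>"
      using K \<eta> by (simp add: field_simps)
    finally show "\<forall>\<^sub>F n in sequentially. real n * (lam (x n))\<^sup>2 \<le> \<eta>"
      using main[OF K(1)] by (auto elim!: eventually_mono)
  qed
qed

end

theorem theorem8p2:
  fixes M :: "'a measure" and \<xi> :: "nat \<Rightarrow> 'a \<Rightarrow> real" and F :: "real measure"
    and T :: ereal and p :: "real \<Rightarrow> real" and c \<beta> t :: real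
  assumes "prob_space M"
    and "iid_family M \<xi> F"
    and "0 < T"
    and "integrable M (\<xi> 0)" and "integral\<^sup>L M (\<xi> 0) = 0"
    and "integrable M (\<lambda>\<omega>. (\<xi> 0 \<omega>)\<^sup>2)" and "integral\<^sup>L M (\<lambda>\<omega>. (\<xi> 0 \<omega>)\<^sup>2) = 1"
    and "\<beta> > 1" and "c > 0"
    and "pos_measurable_near_infinity p"
    and "long_tailed p"
    and "intermediate_regularly_varying p"
    and "\<forall>\<^sub>F x in at_top. measure F (shift_Delta x T) = p x * exp (- c * ln x powr \<beta>)"
    and "t > 2 powr (1 - \<beta>) * c"
  shows "(\<beta> < 2 \<longrightarrow>
           local_large_deviations M \<xi> F T (\<lambda>n. sqrt (t * real n * ln (real n) powr \<beta>))) \<and>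
         (\<beta> \<ge> 2 \<longrightarrow>
           (\<forall>x. (\<forall>\<^sub>F n in sequentially. 0 < x n) \<and>
                (\<lambda>n. sqrt (real n * ln (real n) powr (2 * \<beta> - 2)) / x n) \<longlonglongrightarrow> 0 \<longrightarrow>
                local_large_deviations M \<xi> F T x))"
proof -
  interpret prob_space M
    by fact
  interpret heavy_walk M \<xi> F p "\<lambda>x. measure F (shift_Delta x T)" c \<beta> T
  proof unfold_locales
    show "indep_vars (\<lambda>_. borel) \<xi> UNIV" "\<And>i. distr M borel (\<xi> i) = F"
      using \<open>iid_family M \<xi> F\<close> by (auto simp: iid_family_def)
    show "\<forall>\<^sub>F x in at_top. 0 < p x"
      using \<open>pos_measurable_near_infinity p\<close>
      by (auto simp: pos_measurable_near_infinity_def eventually_at_top_linorder)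
    show "\<exists>d>0. \<exists>X. \<forall>x\<ge>X. \<forall>z. x \<le> z \<and> z \<le> x * (1 + d) \<longrightarrow> \<bar>ln (p z) - ln (p x)\<bar> \<le> e"
      if "e > 0" for e
      using intermediate_rv_uniform that assms(10,12) by blast
  qed (use assms in auto)
  show ?thesis
    using local_large_deviations_sqrt[of t] local_large_deviations_beyond assms(14) by auto
qed

end
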